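(* Let $S=K[x_1,\ldots,x_n]$ be a polynomial ring over a field $K$ and let $I$ be a proper squarefree monomial ideal of $S$. The following conditions are equivalent: (1) $\operatorname{pd}_S S/I=\mu(I)-1$. (2) The hypergraph $\mathcal{H}:=\mathcal{H}(I)$ satisfies $B(\mathcal{H})\neq V(\mathcal{H})$ and at least one of the following conditions: (i) The graph $(W(\mathcal{H}),\mathcal{H}^{1}_{W(\mathcal{H})})$ contains a complete bipartite graph as a spanning subgraph. (ii) There exists $i\in B(\mathcal{H})$ such that $\{i,j\}\in\mathcal{H}$ for all $j\in W(\mathcal{H})$.
   Context: Let $G(I)=\{m_1,\ldots,m_\mu\}$ be the minimal set of monomial generators of $I$ and $\mu(I)=\mu$ its cardinality. The hypergraph of $I$ is the collection of subsets of the vertex set $V(\mathcal{H}(I))=[\mu]=\{1,\ldots,\mu\}$ given by $$\mathcal{H}(I)=\big\{\{j\in[\mu] : m_j \text{ is divisible by } x_i\} : i=1,\ldots,n\big\}.$$ For a hypergraph $\mathcal{H}$ on vertex set $V(\mathcal H)$ (a collection of subsets of $V(\mathcal H)$, called faces, whose union is $V(\mathcal H)$): $B(\mathcal{H})=\{v\in V(\mathcal H):\{v\}\in\mathcal{H}\}$ and $W(\mathcal{H})=V(\mathcal{H})\setminus B(\mathcal{H})$. For $U\subset V(\mathcal{H})$, $\mathcal{H}^1_U$ denotes the set of faces $F\in\mathcal{H}$ with $F\subset U$ and $|F|=2$; thus $(U,\mathcal{H}^1_U)$ is a simple graph with vertex set $U$ and edge set $\mathcal{H}^1_U$. A complete bipartite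 graph has both of its parts nonempty. $\operatorname{pd}_S$ denotes projective dimension over $S$. *)

theory Defs
  imports
    "HOL-Algebra.Algebraic_Closure_Type"
    "HOL-Library.Poly_Mapping"
    "HOL-Library.Extended_Nat"
begin

section \<open>Projective dimension\<close>

definition module_homs ::
    "('a, 'r) ring_scheme \<Rightarrow> ('a, 'b, 'p) module_scheme \<Rightarrow> ('a, 'c, 'q) module_scheme \<Rightarrow> ('b \<Rightarrow> 'c) set" where
  "module_homs R M N =
    {f \<in> hom (add_monoid M) (add_monoid N).
       \<forall>r \<in> carrier R. \<forall>x \<in> carrier M. f (r \<odot>\<^bsub>M\<^esub> x) = r \<odot>\<^bsub>N\<^esub> f x}"

text \<open>The lifting property of \<open>P\<close>. Quantified types cannot be arbitrary in HOL, but nothing is lost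
  by restricting \<open>L\<close> and \<open>N\<close> as below: the free module on the set \<open>carrier P\<close> is carried by finitely
  supported functions of type \<open>'p \<Rightarrow> 'a\<close>, and lifting the identity of \<open>P\<close> along its canonical
  surjection onto \<open>P\<close> already makes \<open>P\<close> a direct summand of a free module.\<close>

definition projective_module :: "('a, 'r) ring_scheme \<Rightarrow> ('a, 'p) module \<Rightarrow> bool" where
  "projective_module R P \<longleftrightarrow> module R P \<and>
    (\<forall>(N :: ('a, 'p \<Rightarrow> 'a) module) (L :: ('a, 'p) module) g f.
       module R N \<longrightarrow> module R L \<longrightarrow>
       g \<in> module_homs R N L \<longrightarrow> g ` carrier N = carrier L \<longrightarrow>
       f \<in> module_homs R P L \<longrightarrow>
       (\<exists>h \<in> module_homs R P N. \<forall>x \<in> carrier P. g (h x) = f x))"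

text \<open>\<open>d i\<close> is the differential from \<open>P (i + 1)\<close> to \<open>P i\<close>, and \<open>e\<close> is the augmentation from \<open>P 0\<close> to \<open>M\<close>.\<close>

definition projective_resolution ::
    "('a, 'r) ring_scheme \<Rightarrow> ('a, 'm) module \<Rightarrow> (nat \<Rightarrow> ('a, 'p) module) \<Rightarrow>
     (nat \<Rightarrow> 'p \<Rightarrow> 'p) \<Rightarrow> ('p \<Rightarrow> 'm) \<Rightarrow> bool" where
  "projective_resolution R M P d e \<longleftrightarrow>
    (\<forall>i. projective_module R (P i)) \<and>
    e \<in> module_homs R (P 0) M \<and>
    (\<forall>i. d i \<in> module_homs R (P (Suc i)) (P i)) \<and>
    e ` carrier (P 0) = carrier M \<and>
    d 0 ` carrier (P (Suc 0)) = {x \<in> carrier (P 0). e x = \<zero>\<^bsub>M\<^esub>} \<and>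
    (\<forall>i. d (Suc i) ` carrier (P (Suc (Suc i))) = {x \<in> carrier (P (Suc i)). d i x = \<zero>\<^bsub>P i\<^esub>})"

text \<open>The least length of a projective resolution, \<open>\<infinity>\<close> if there is no finite one (and \<open>0\<close> for the
  zero module). The terms of the resolutions are carried by subsets of the type
  \<open>nat \<times> 'a \<times> 'm \<Rightarrow> 'a\<close>. It contains free modules on index sets as large as \<open>nat \<times> 'a \<times> 'm\<close>, an infinite
  type at least as large as \<open>R\<close> and \<open>M\<close>; hence it contains a free cover of \<open>M\<close>, a free cover of the
  kernel, and so on, together with all these kernels. By Schanuel's lemma no shorter resolution
  can be found in a larger type.\<close>

definition projective_dimension :: "('a, 'r) ring_scheme \<Rightarrow> ('a, 'm) module \<Rightarrow> enat" where
  "projective_dimension R M =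
    Inf {enat k | k.
      \<exists>(P :: nat \<Rightarrow> ('a, nat \<times> 'a \<times> 'm \<Rightarrow> 'a) module) d e.
        projective_resolution R M P d e \<and> (\<forall>i > k. carrier (P i) = {\<zero>\<^bsub>P i\<^esub>})}"

definition quotient_module :: "('a, 'r) ring_scheme \<Rightarrow> 'a set \<Rightarrow> ('a, 'a set) module" where
  "quotient_module R I =
    \<lparr>carrier = carrier (R Quot I), monoid.mult = monoid.mult (R Quot I), one = one (R Quot I),
     ring.zero = ring.zero (R Quot I), add = add (R Quot I),
     module.smult = (\<lambda>r C. (I +>\<^bsub>R\<^esub> r) \<otimes>\<^bsub>R Quot I\<^esub> C)\<rparr>"


section \<open>Monomial ideals\<close>

text \<open>Polynomials over \<open>'k\<close> in variables indexed by \<open>'n\<close>: a monomial is given by its exponent vector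
  in \<open>'n \<Rightarrow>\<^sub>0 nat\<close>, a polynomial by its finitely supported coefficient function.\<close>

type_synonym ('n, 'k) mpoly = "('n \<Rightarrow>\<^sub>0 nat) \<Rightarrow>\<^sub>0 'k"

abbreviation polynomial_ring :: "('n, 'k :: comm_ring_1) mpoly ring" where
  "polynomial_ring \<equiv> ring_of_type_algebra"

definition indeterminate :: "'n \<Rightarrow> ('n, 'k :: comm_ring_1) mpoly" where
  "indeterminate i = Poly_Mapping.single (Poly_Mapping.single i 1) 1"

definition monomials :: "('n, 'k :: comm_ring_1) mpoly set" where
  "monomials = {Poly_Mapping.single a 1 | a. True}"

definition squarefree_monomials :: "('n, 'k :: comm_ring_1) mpoly set" where
  "squarefree_monomials = {Poly_Mapping.single a 1 | a. \<forall>i. Poly_Mapping.lookup a i \<le> 1}"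

definition squarefree_monomial_ideal :: "('n, 'k :: comm_ring_1) mpoly set \<Rightarrow> bool" where
  "squarefree_monomial_ideal I \<longleftrightarrow>
    (\<exists>A \<subseteq> squarefree_monomials. I = Idl\<^bsub>polynomial_ring\<^esub> A)"

text \<open>Every monomial ideal \<open>I\<close> has exactly one such \<open>G\<close>.\<close>

definition minimal_monomial_generators ::
    "('n, 'k :: comm_ring_1) mpoly set \<Rightarrow> ('n, 'k) mpoly set \<Rightarrow> bool" where
  "minimal_monomial_generators I G \<longleftrightarrow>
    G \<subseteq> monomials \<and> Idl\<^bsub>polynomial_ring\<^esub> G = I \<and>
    (\<forall>H. H \<subset> G \<longrightarrow> Idl\<^bsub>polynomial_ring\<^esub> H \<noteq> I)"


section \<open>Hypergraphs\<close>

text \<open>A hypergraph is given by its vertex set \<open>V\<close> and its set \<open>H\<close> of faces.\<close>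

definition singleton_vertices :: "'v set \<Rightarrow> 'v set set \<Rightarrow> 'v set" where
  "singleton_vertices V H = {v \<in> V. {v} \<in> H}"

definition nonsingleton_vertices :: "'v set \<Rightarrow> 'v set set \<Rightarrow> 'v set" where
  "nonsingleton_vertices V H = V - singleton_vertices V H"

definition two_faces_in :: "'v set set \<Rightarrow> 'v set \<Rightarrow> 'v set set" where
  "two_faces_in H U = {F \<in> H. F \<subseteq> U \<and> card F = 2}"

definition complete_bipartite_graph :: "'v set \<Rightarrow> 'v set set \<Rightarrow> bool" where
  "complete_bipartite_graph V E \<longleftrightarrow>
    (\<exists>A B. A \<noteq> {} \<and> B \<noteq> {} \<and> A \<inter> B = {} \<and> A \<union> B = V \<and> E = {{a, b} | a b. a \<in> A \<and> b \<in> B})"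

definition has_spanning_complete_bipartite_subgraph :: "'v set \<Rightarrow> 'v set set \<Rightarrow> bool" where
  "has_spanning_complete_bipartite_subgraph V E \<longleftrightarrow>
    (\<exists>E' \<subseteq> E. complete_bipartite_graph V E')"

text \<open>The hypergraph on \<open>{1..\<mu>}\<close> of an ideal minimally generated by \<open>m 1, \<dots>, m \<mu>\<close>.\<close>

definition ideal_hypergraph :: "nat \<Rightarrow> (nat \<Rightarrow> ('n, 'k :: comm_ring_1) mpoly) \<Rightarrow> nat set set" where
  "ideal_hypergraph \<mu> m = {{j \<in> {1..\<mu>}. indeterminate i dvd m j} | i. True}"

end

theory Submission
  imports Defs
begin

text \<open>Let \<open>L\<close> be the least common multiple of the generators. In the Taylor resolution \<open>T\<close> of
  \<open>S/I\<close> the face \<open>V - {i}\<close> has degree \<open>L\<close> exactly for \<open>i \<in> W\<close>, and for \<open>a, b \<in> W\<close> the pair \<open>{a, b}\<close>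
  is a face of the hypergraph exactly if the degree of \<open>V - {a, b}\<close> is smaller than \<open>L\<close>.

  A projective resolution of length \<open>k\<close> is homotopy equivalent to \<open>T\<close>, which yields
  \<open>x = d (s x) + s (d x)\<close> on \<open>T\<close> above degree \<open>k\<close>. So no chain above degree \<open>k\<close> can be a cycle modulo
  the maximal ideal without being a boundary modulo it. The top face (if \<open>W\<close> is empty), one half of
  its boundary (for a bipartition of \<open>W\<close>) and the face \<open>V - {i}\<close> (for \<open>i \<in> B\<close> adjacent to all of
  \<open>W\<close>) are such cycles.

  If \<open>W\<close> is nonempty, one entry of the last differential of \<open>T\<close> is a unit, so \<open>T\<close> can be shortened
  by one step. If moreover (i) and (ii) fail, then the complement of the graph on \<open>W\<close> is connected
  and every \<open>i \<in> B\<close> is attached to it by a non-adjacent \<open>j \<in> W\<close>; a spanning tree of the resulting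
  graph on \<open>V\<close> provides a unitriangular minor of the next differential, and \<open>T\<close> can be shortened
  once more.\<close>


section \<open>Modules and projective resolutions\<close>

text \<open>The criterion for faces has a simple source. A variable that is lost from the lcm when
  \<open>a\<close> and \<open>b\<close> are removed divides no other generator; if removing
  \<open>a\<close> alone or \<open>b\<close> alone loses nothing, it divides both, so its face is
  exactly \<open>{a, b}\<close>. For a vertex \<open>i\<close> in \<open>B\<close> variables are
  lost with \<open>i\<close> in any case, and the comparison is with the lcm of
  \<open>V - {i}\<close> instead of \<open>L\<close>. Minimal resolutions and Tor do not occur. A
  chain is tested modulo the maximal ideal by its coefficient at each face in one single degree, the
  lcm of that face, where a multiple of a variable has coefficient zero. Shortening means to find
  faces in degree \<open>k\<close> whose chains form a complement of the boundaries; the complex may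
  be cut off at such a complement. An obstacle of a different kind is that projectivity and
  projective dimension are defined with modules on prescribed types. Lifting is therefore first
  freed from its test types, and the finished resolution is moved along an injection.\<close>

lemma type_ring_simps [simp]:
  "carrier ring_of_type_algebra = UNIV"
  "monoid.mult ring_of_type_algebra = (*)"
  "one ring_of_type_algebra = 1"
  "ring.zero ring_of_type_algebra = 0"
  "add ring_of_type_algebra = (+)"
  by (simp_all add: ring_of_type_algebra_def fun_eq_iff)

lemma module_homsI:
  assumes "\<And>x. x \<in> carrier M \<Longrightarrow> f x \<in> carrier N"
    and "\<And>x y. x \<in> carrier M \<Longrightarrow> y \<in> carrier M \<Longrightarrow> f (x \<oplus>\<^bsub>M\<^esub> y) = f x \<oplus>\<^bsub>N\<^esub> f y"
    and "\<And>r x. r \<in> carrier R \<Longrightarrow> x \<in> carrier M \<Longrightarrow> f (r \<odot>\<^bsub>M\<^esub> x) = r \<odot>\<^bsub>N\<^esub> f x"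
  shows "f \<in> module_homs R M N"
  using assms by (auto simp: module_homs_def hom_def)

lemma module_homs_closed: "f \<in> module_homs R M N \<Longrightarrow> x \<in> carrier M \<Longrightarrow> f x \<in> carrier N"
  by (auto simp: module_homs_def hom_def)

lemma module_homs_add:
  "f \<in> module_homs R M N \<Longrightarrow> x \<in> carrier M \<Longrightarrow> y \<in> carrier M \<Longrightarrow>
    f (x \<oplus>\<^bsub>M\<^esub> y) = f x \<oplus>\<^bsub>N\<^esub> f y"
  by (auto simp: module_homs_def hom_def)

lemma module_homs_smult:
  "f \<in> module_homs R M N \<Longrightarrow> r \<in> carrier R \<Longrightarrow> x \<in> carrier M \<Longrightarrow>
    f (r \<odot>\<^bsub>M\<^esub> x) = r \<odot>\<^bsub>N\<^esub> f x"
  by (auto simp: module_homs_def)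

lemma module_homs_zero:
  assumes "module R M" "module R N" "f \<in> module_homs R M N"
  shows "f \<zero>\<^bsub>M\<^esub> = \<zero>\<^bsub>N\<^esub>"
proof -
  interpret M: module R M by fact
  interpret N: module R N by fact
  have "f \<zero>\<^bsub>M\<^esub> = f (\<zero>\<^bsub>R\<^esub> \<odot>\<^bsub>M\<^esub> \<zero>\<^bsub>M\<^esub>)" by simp
  also have "\<dots> = \<zero>\<^bsub>R\<^esub> \<odot>\<^bsub>N\<^esub> f \<zero>\<^bsub>M\<^esub>" by (intro module_homs_smult[OF assms(3)]) auto
  also have "\<dots> = \<zero>\<^bsub>N\<^esub>" by (simp add: module_homs_closed[OF assms(3)])
  finally show ?thesis .
qed

lemma module_homs_comp:
  "f \<in> module_homs R M N \<Longrightarrow> g \<in> module_homs R N L \<Longrightarrow> (\<lambda>x. g (f x)) \<in> module_homs R M L"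
  by (intro module_homsI) (simp_all add: module_homs_closed module_homs_add module_homs_smult)

lemma (in module) minus_eq_smult: "x \<in> carrier M \<Longrightarrow> \<ominus>\<^bsub>M\<^esub> x = (\<ominus> \<one>) \<odot>\<^bsub>M\<^esub> x"
  by (simp add: smult_l_minus)

lemma module_homs_minus:
  assumes "module R M" "module R N" "f \<in> module_homs R M N" "x \<in> carrier M" "y \<in> carrier M"
  shows "f (x \<ominus>\<^bsub>M\<^esub> y) = f x \<ominus>\<^bsub>N\<^esub> f y"
proof -
  interpret M: module R M by fact
  interpret N: module R N by fact
  show ?thesis using assms(4,5)
    by (simp add: a_minus_def M.minus_eq_smult N.minus_eq_smult module_homs_closed[OF assms(3)]
        module_homs_add[OF assms(3)] module_homs_smult[OF assms(3)])
qed

lemma module_homs_diff: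
  assumes "module R N" "f \<in> module_homs R M N" "g \<in> module_homs R M N"
  shows "(\<lambda>x. f x \<ominus>\<^bsub>N\<^esub> g x) \<in> module_homs R M N"
proof -
  interpret N: module R N by fact
  show ?thesis
  proof (rule module_homsI)
    fix x y assume xy: "x \<in> carrier M" "y \<in> carrier M"
    note c = xy[THEN module_homs_closed[OF assms(2)]] xy[THEN module_homs_closed[OF assms(3)]]
    show "f (x \<oplus>\<^bsub>M\<^esub> y) \<ominus>\<^bsub>N\<^esub> g (x \<oplus>\<^bsub>M\<^esub> y) = (f x \<ominus>\<^bsub>N\<^esub> g x) \<oplus>\<^bsub>N\<^esub> (f y \<ominus>\<^bsub>N\<^esub> g y)"
      using c by (simp add: module_homs_add[OF assms(2) xy] module_homs_add[OF assms(3) xy]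
        a_minus_def N.minus_add N.a_ac)
  next
    fix r x assume rx: "r \<in> carrier R" "x \<in> carrier M"
    note c = rx(2)[THEN module_homs_closed[OF assms(2)]] rx(2)[THEN module_homs_closed[OF assms(3)]]
    show "f (r \<odot>\<^bsub>M\<^esub> x) \<ominus>\<^bsub>N\<^esub> g (r \<odot>\<^bsub>M\<^esub> x) = r \<odot>\<^bsub>N\<^esub> (f x \<ominus>\<^bsub>N\<^esub> g x)"
      using c rx by (simp add: module_homs_smult[OF assms(2) rx] module_homs_smult[OF assms(3) rx]
        a_minus_def N.smult_r_distr N.smult_r_minus)
  qed (simp add: module_homs_closed[OF assms(2)] module_homs_closed[OF assms(3)])
qed

lemma module_homs_ident: "(\<lambda>x. x) \<in> module_homs R M M"
  by (rule module_homsI) auto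


text \<open>With nonzerodivisors as weights \<open>w\<close> this is a free module. Realising the summand of \<open>t\<close> as
  the ideal \<open>(w t)\<close> lets the Taylor complex below have the differential of a simplex, without any
  quotients of monomials.\<close>

definition weighted_free_module ::
    "'q set \<Rightarrow> ('q \<Rightarrow> 'a :: comm_ring_1) \<Rightarrow> ('a, 'q \<Rightarrow> 'a) module" where
  "weighted_free_module J w =
    \<lparr>carrier = {y. finite {t. y t \<noteq> 0} \<and> (\<forall>t. (t \<notin> J \<longrightarrow> y t = 0) \<and> w t dvd y t)},
     monoid.mult = (\<lambda>_ _. undefined), one = undefined,
     ring.zero = (\<lambda>_. 0), add = (\<lambda>x y t. x t + y t),
     module.smult = (\<lambda>r x t. r * x t)\<rparr>"

lemma weighted_free_simps [simp]:
  "y \<in> carrier (weighted_free_module J w) \<longleftrightarrow>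
     finite {t. y t \<noteq> 0} \<and> (\<forall>t. (t \<notin> J \<longrightarrow> y t = 0) \<and> w t dvd y t)"
  "\<zero>\<^bsub>weighted_free_module J w\<^esub> = (\<lambda>_. 0)"
  "x \<oplus>\<^bsub>weighted_free_module J w\<^esub> y = (\<lambda>t. x t + y t)"
  "r \<odot>\<^bsub>weighted_free_module J w\<^esub> x = (\<lambda>t. r * x t)"
  by (simp_all add: weighted_free_module_def)

lemma finite_support_add:
  fixes x y :: "'q \<Rightarrow> 'a :: monoid_add"
  assumes "finite {t. x t \<noteq> 0}" "finite {t. y t \<noteq> 0}"
  shows "finite {t. x t + y t \<noteq> 0}"
  by (rule finite_subset[OF _ finite_UnI[OF assms]]) auto

lemma finite_support_mult:
  fixes y :: "'q \<Rightarrow> 'a :: mult_zero"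
  assumes "finite {t. y t \<noteq> 0}"
  shows "finite {t. r * y t \<noteq> 0}"
  by (rule finite_subset[OF _ assms]) auto

lemma module_weighted_free:
  "module (ring_of_type_algebra :: 'a :: comm_ring_1 ring) (weighted_free_module J w)"
proof (rule moduleI)
  show "abelian_group (weighted_free_module J w)"
  proof (rule abelian_groupI)
    fix x assume x: "x \<in> carrier (weighted_free_module J w)"
    have "(\<lambda>t. - x t) \<in> carrier (weighted_free_module J w)"
      using x by simp
    then show "\<exists>y\<in>carrier (weighted_free_module J w).
        y \<oplus>\<^bsub>weighted_free_module J w\<^esub> x = \<zero>\<^bsub>weighted_free_module J w\<^esub>"
      by (rule bexI[rotated]) simp
  qed (auto simp: finite_support_add fun_eq_iff algebra_simps)
qed (auto simp: cring_from_type_algebra finite_support_mult fun_eq_iff algebra_simps)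

definition weighted_basis :: "('q \<Rightarrow> 'a :: zero) \<Rightarrow> 'q \<Rightarrow> 'q \<Rightarrow> 'a" where
  "weighted_basis w t = (\<lambda>u. if u = t then w t else 0)"

lemma weighted_basis_carrier:
  fixes w :: "'q \<Rightarrow> 'a :: comm_ring_1"
  shows "t \<in> J \<Longrightarrow> weighted_basis w t \<in> carrier (weighted_free_module J w)"
  by (auto simp: weighted_basis_def intro: finite_subset[of _ "{t}"])

lemma weighted_free_homs_eqI:
  fixes w :: "'q \<Rightarrow> 'a :: comm_ring_1"
  assumes N: "module ring_of_type_algebra N"
    and f: "f \<in> module_homs ring_of_type_algebra (weighted_free_module J w) N"
    and g: "g \<in> module_homs ring_of_type_algebra (weighted_free_module J w) N"
    and eq: "\<And>t. t \<in> J \<Longrightarrow> f (weighted_basis w t) = g (weighted_basis w t)"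
    and y: "y \<in> carrier (weighted_free_module J w)"
  shows "f y = g y"
proof -
  let ?F = "weighted_free_module J w"
  have *: "f y = g y" if "finite A" "{t. y t \<noteq> 0} \<subseteq> A" "y \<in> carrier ?F" for A y
    using that
  proof (induction A arbitrary: y rule: finite_induct)
    case empty
    then have "y = \<zero>\<^bsub>?F\<^esub>" by (auto simp: fun_eq_iff)
    then show ?case
      using module_homs_zero[OF module_weighted_free N f] module_homs_zero[OF module_weighted_free
          N g]
      by simp
  next
    case (insert t A)
    show ?case
    proof (cases "t \<in> J")
      case False
      with insert.prems have "y t = 0" by simp
      with insert.prems have "{t. y t \<noteq> 0} \<subseteq> A" by auto
      then show ?thesis using insert.IH insert.prems by blast
    next
      case True
      define z where "z = y(t := 0)"
      from insert.prems(2) obtain q where q: "y t = w t * q" by (auto simp: dvd_def)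
      have "{u. z u \<noteq> 0} \<subseteq> {u. y u \<noteq> 0}" by (auto simp: z_def)
      then have "finite {u. z u \<noteq> 0}"
        by (rule finite_subset) (use insert.prems(2) in simp)
      then have z: "z \<in> carrier ?F"
        using insert.prems(2) by (auto simp: z_def)
      have fz: "f z = g z"
        using insert.prems by (intro insert.IH z) (auto simp: z_def)
      have b: "weighted_basis w t \<in> carrier ?F" by (rule weighted_basis_carrier[OF True])
      then have qb: "q \<odot>\<^bsub>?F\<^esub> weighted_basis w t \<in> carrier ?F"
        by (auto simp: finite_support_mult)
      have "y = z \<oplus>\<^bsub>?F\<^esub> q \<odot>\<^bsub>?F\<^esub> weighted_basis w t"
        by (auto simp: fun_eq_iff z_def weighted_basis_def q mult.commute)
      then show ?thesis
        using fz module_homs_add[OF f z qb] module_homs_add[OF g z qb]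
          module_homs_smult[OF f _ b, of q] module_homs_smult[OF g _ b, of q] eq[OF True] by simp
    qed
  qed
  from y have "finite {t. y t \<noteq> 0}" by simp
  from *[OF this subset_refl y] show ?thesis .
qed

lemma weighted_free_extend:
  fixes w :: "'q \<Rightarrow> 'a :: comm_ring_1"
  assumes N: "module ring_of_type_algebra N"
    and w: "\<forall>t \<in> J. inj ((*) (w t))"
    and n: "n \<in> J \<rightarrow> carrier N"
  shows "\<exists>h \<in> module_homs ring_of_type_algebra (weighted_free_module J w) N.
    \<forall>t \<in> J. h (weighted_basis w t) = n t"
proof -
  interpret N: module ring_of_type_algebra N by fact
  let ?F = "weighted_free_module J w"
  \<comment> \<open>Since \<open>w t\<close> is a nonzerodivisor, the quotient of \<open>y t\<close>
    by \<open>w t\<close> is unique; uniqueness is what makes \<open>q\<close> linear in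
    \<open>y\<close>.\<close>
  define q where "q y t = (THE x. y t = w t * x)" for y t
  have q_eq: "q y t = x" if "t \<in> J" "y t = w t * x" for y t x
    unfolding q_def by (rule the_equality) (use that w in \<open>auto dest!: bspec injD\<close>)
  have yq: "y t = w t * q y t" if "t \<in> J" "y \<in> carrier ?F" for y t
  proof -
    from that obtain x where "y t = w t * x" by (auto simp: dvd_def)
    with that q_eq[of t y x] show ?thesis by simp
  qed
  define h where "h y = (\<Oplus>\<^bsub>N\<^esub>t\<in>{t. y t \<noteq> 0}. q y t \<odot>\<^bsub>N\<^esub> n t)" for y
  have cl: "(\<lambda>t. q y t \<odot>\<^bsub>N\<^esub> n t) \<in> A \<rightarrow> carrier N" if "A \<subseteq> J" for y A
    using that n by (auto intro!: N.smult_closed)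
  \<comment> \<open>Supports vary with the chain, so the defining sum is extended to any finite set
    that contains the support; the additional terms have \<open>q y t = 0\<close>.\<close>
  have h_eq: "h y = (\<Oplus>\<^bsub>N\<^esub>t\<in>A. q y t \<odot>\<^bsub>N\<^esub> n t)"
    if "finite A" "{t. y t \<noteq> 0} \<subseteq> A" "A \<subseteq> J" "y \<in> carrier ?F" for y A
    unfolding h_def
  proof (rule N.add.finprod_mono_neutral_cong_left)
    fix t assume t: "t \<in> A - {t. y t \<noteq> 0}"
    then have "q y t = 0" using that by (intro q_eq) auto
    then show "q y t \<odot>\<^bsub>N\<^esub> n t = \<zero>\<^bsub>N\<^esub>"
      using N.smult_l_null[of "n t"] n t that by auto
  qed (use that cl in auto)
  show ?thesis
  proof (intro bexI ballI)
    show "h \<in> module_homs ring_of_type_algebra ?F N"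
    proof (rule module_homsI)
      fix x assume "x \<in> carrier ?F"
      then show "h x \<in> carrier N" unfolding h_def by (intro N.finsum_closed cl) auto
    next
      fix x y assume x: "x \<in> carrier ?F" and y: "y \<in> carrier ?F"
      let ?A = "{t. x t \<noteq> 0} \<union> {t. y t \<noteq> 0}"
      have A: "finite ?A" "?A \<subseteq> J" using x y by auto
      have xy: "x \<oplus>\<^bsub>?F\<^esub> y \<in> carrier ?F"
        using x y by (simp add: finite_support_add)
      have "h (x \<oplus>\<^bsub>?F\<^esub> y) = (\<Oplus>\<^bsub>N\<^esub>t\<in>?A. q (x \<oplus>\<^bsub>?F\<^esub> y) t \<odot>\<^bsub>N\<^esub> n t)"
        by (rule h_eq[OF A(1) _ A(2) xy]) auto
      also have "\<dots> = (\<Oplus>\<^bsub>N\<^esub>t\<in>?A. q x t \<odot>\<^bsub>N\<^esub> n t \<oplus>\<^bsub>N\<^esub> q y t \<odot>\<^bsub>N\<^esub> n t)"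
      proof (rule N.add.finprod_cong')
        fix t assume t: "t \<in> ?A"
        then have tJ: "t \<in> J" using A(2) by auto
        have "q (x \<oplus>\<^bsub>?F\<^esub> y) t = q x t + q y t"
          by (rule q_eq[OF tJ]) (simp add: yq[OF tJ x] yq[OF tJ y] ring_distribs)
        then show "q (x \<oplus>\<^bsub>?F\<^esub> y) t \<odot>\<^bsub>N\<^esub> n t = q x t \<odot>\<^bsub>N\<^esub> n t \<oplus>\<^bsub>N\<^esub> q y t \<odot>\<^bsub>N\<^esub> n t"
          using N.smult_l_distr[of "q x t" "q y t" "n t"] funcset_mem[OF n tJ] by simp
      qed (use A n in \<open>auto intro!: N.smult_closed N.a_closed\<close>)
      also have "\<dots> = h x \<oplus>\<^bsub>N\<^esub> h y"
        using h_eq[OF A(1) _ A(2) x] h_eq[OF A(1) _ A(2) y] N.finsum_addf[OF cl[OF A(2)] cl[OF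
            A(2)]]
        by simp
      finally show "h (x \<oplus>\<^bsub>?F\<^esub> y) = h x \<oplus>\<^bsub>N\<^esub> h y" .
    next
      fix r x assume x: "x \<in> carrier ?F"
      let ?A = "{t. x t \<noteq> 0}"
      have A: "finite ?A" "?A \<subseteq> J" using x by auto
      have rx: "r \<odot>\<^bsub>?F\<^esub> x \<in> carrier ?F"
        using x by (simp add: finite_support_mult)
      have "h (r \<odot>\<^bsub>?F\<^esub> x) = (\<Oplus>\<^bsub>N\<^esub>t\<in>?A. q (r \<odot>\<^bsub>?F\<^esub> x) t \<odot>\<^bsub>N\<^esub> n t)"
        by (rule h_eq[OF A(1) _ A(2) rx]) auto
      also have "\<dots> = (\<Oplus>\<^bsub>N\<^esub>t\<in>?A. r \<odot>\<^bsub>N\<^esub> (q x t \<odot>\<^bsub>N\<^esub> n t))"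
      proof (rule N.add.finprod_cong')
        fix t assume t: "t \<in> ?A"
        then have tJ: "t \<in> J" using A(2) by auto
        have "q (r \<odot>\<^bsub>?F\<^esub> x) t = r * q x t"
          by (rule q_eq[OF tJ]) (simp add: yq[OF tJ x] mult_ac)
        then show "q (r \<odot>\<^bsub>?F\<^esub> x) t \<odot>\<^bsub>N\<^esub> n t = r \<odot>\<^bsub>N\<^esub> (q x t \<odot>\<^bsub>N\<^esub> n t)"
          using N.smult_assoc1[of r "q x t" "n t"] funcset_mem[OF n tJ] by simp
      qed (use A n in \<open>auto intro!: N.smult_closed\<close>)
      also have "\<dots> = r \<odot>\<^bsub>N\<^esub> h x"
        unfolding h_def by (rule N.finsum_smult_ldistr[symmetric, OF A(1) _ cl[OF A(2)]]) simp
      finally show "h (r \<odot>\<^bsub>?F\<^esub> x) = r \<odot>\<^bsub>N\<^esub> h x" .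
    qed
    fix t assume t: "t \<in> J"
    have "h (weighted_basis w t) = (\<Oplus>\<^bsub>N\<^esub>u\<in>{t}. q (weighted_basis w t) u \<odot>\<^bsub>N\<^esub> n u)"
      using t by (intro h_eq weighted_basis_carrier) (auto simp: weighted_basis_def)
    also have "\<dots> = q (weighted_basis w t) t \<odot>\<^bsub>N\<^esub> n t"
      using funcset_mem[OF n t] by (simp add: N.smult_closed)
    also have "q (weighted_basis w t) t = 1"
      by (rule q_eq[OF t]) (simp add: weighted_basis_def)
    finally show "h (weighted_basis w t) = n t"
      using funcset_mem[OF n t] N.smult_one[of "n t"] by simp
  qed
qed

text \<open>Demanding only that the image of \<open>f\<close> lies in the image of \<open>g\<close>
  lets lifts be taken along a differential, which reaches the cycles but not the whole
  module.\<close>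

lemma weighted_free_lift:
  fixes w :: "'q \<Rightarrow> 'a :: comm_ring_1"
  assumes N: "module ring_of_type_algebra N" and L: "module ring_of_type_algebra L"
    and w: "\<forall>t \<in> J. inj ((*) (w t))"
    and g: "g \<in> module_homs ring_of_type_algebra N L"
    and f: "f \<in> module_homs ring_of_type_algebra (weighted_free_module J w) L"
    and fg: "f ` carrier (weighted_free_module J w) \<subseteq> g ` carrier N"
  shows "\<exists>h \<in> module_homs ring_of_type_algebra (weighted_free_module J w) N.
    \<forall>x \<in> carrier (weighted_free_module J w). g (h x) = f x"
proof -
  have "\<exists>n\<in>carrier N. g n = f (weighted_basis w t)" if "t \<in> J" for t
  proof -
    have "f (weighted_basis w t) \<in> g ` carrier N"
      using fg weighted_basis_carrier[OF that, of w] by blast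
    then show ?thesis by auto
  qed
  then obtain n where n: "n \<in> J \<rightarrow> carrier N" "\<forall>t\<in>J. g (n t) = f (weighted_basis w t)"
    by (metis funcsetI)
  obtain h where h: "h \<in> module_homs ring_of_type_algebra (weighted_free_module J w) N"
    and hn: "\<forall>t\<in>J. h (weighted_basis w t) = n t"
    using weighted_free_extend[where J = J and w = w and n = n, OF N w n(1)] by blast
  have "g (h x) = f x" if "x \<in> carrier (weighted_free_module J w)" for x
    by (rule weighted_free_homs_eqI[OF L module_homs_comp[OF h g] f _ that]) (simp add: n hn)
  with h show ?thesis by blast
qed

lemma projective_weighted_free:
  fixes w :: "'q \<Rightarrow> 'a :: comm_ring_1"
  assumes w: "\<forall>t \<in> J. inj ((*) (w t))"
  shows "projective_module ring_of_type_algebra (weighted_free_module J w)"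
  unfolding projective_module_def
proof (intro conjI allI impI)
  fix N :: "('a, ('q \<Rightarrow> 'a) \<Rightarrow> 'a) module" and L :: "('a, 'q \<Rightarrow> 'a) module" and g f
  assume *: "module ring_of_type_algebra N" "module ring_of_type_algebra L"
    "g \<in> module_homs ring_of_type_algebra N L" "g ` carrier N = carrier L"
    "f \<in> module_homs ring_of_type_algebra (weighted_free_module J w) L"
  have "f ` carrier (weighted_free_module J w) \<subseteq> g ` carrier N"
    using module_homs_closed[OF *(5)] *(4) by blast
  with weighted_free_lift[OF *(1,2) w *(3,5)]
  show "\<exists>h\<in>module_homs ring_of_type_algebra (weighted_free_module J w) N.
      \<forall>x\<in>carrier (weighted_free_module J w). g (h x) = f x"
    by blast
qed (rule module_weighted_free)

text \<open>The definition of projectivity only tests modules carried by particular types. Splitting \<open>P\<close>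
  off a free module removes this restriction.\<close>

lemma projective_module_lift:
  fixes P :: "('a :: comm_ring_1, 'p) module"
  assumes P: "projective_module ring_of_type_algebra P"
    and N: "module ring_of_type_algebra N" and L: "module ring_of_type_algebra L"
    and g: "g \<in> module_homs ring_of_type_algebra N L"
    and f: "f \<in> module_homs ring_of_type_algebra P L"
    and fg: "f ` carrier P \<subseteq> g ` carrier N"
  shows "\<exists>h \<in> module_homs ring_of_type_algebra P N. \<forall>x \<in> carrier P. g (h x) = f x"
proof -
  let ?R = "ring_of_type_algebra :: 'a ring"
  let ?w = "\<lambda>_ :: 'p. 1 :: 'a"
  let ?F = "weighted_free_module (carrier P) ?w"
  have mP: "module ?R P" using P by (simp add: projective_module_def)
  obtain \<pi> where \<pi>: "\<pi> \<in> module_homs ?R ?F P"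
    and \<pi>b: "\<forall>t\<in>carrier P. \<pi> (weighted_basis ?w t) = t"
    using weighted_free_extend[OF mP, of "carrier P" ?w "\<lambda>t. t"] by (auto simp: inj_def)
  have "carrier P \<subseteq> \<pi> ` carrier ?F"
  proof
    fix t assume t: "t \<in> carrier P"
    show "t \<in> \<pi> ` carrier ?F"
      by (rule image_eqI[of _ _ "weighted_basis ?w t"]) (use \<pi>b t weighted_basis_carrier[OF t, of
          ?w] in auto)
  qed
  then have surj: "\<pi> ` carrier ?F = carrier P"
    using module_homs_closed[OF \<pi>] by blast
  \<comment> \<open>The restricted lifting property enters only here: the identity of
    \<open>P\<close> is lifted to a section of \<open>\<pi>\<close>, with the free module on
    \<open>carrier P\<close> as test module.\<close>
  obtain s where s: "s \<in> module_homs ?R P ?F" and \<pi>s: "\<forall>x\<in>carrier P. \<pi> (s x) = x"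
    using P[unfolded projective_module_def, THEN conjunct2, rule_format,
      OF module_weighted_free mP \<pi> surj module_homs_ident] by blast
  have f\<pi>: "(\<lambda>x. f (\<pi> x)) \<in> module_homs ?R ?F L" by (rule module_homs_comp[OF \<pi> f])
  have "(\<lambda>x. f (\<pi> x)) ` carrier ?F \<subseteq> g ` carrier N"
    using fg module_homs_closed[OF \<pi>] by blast
  then obtain h where h: "h \<in> module_homs ?R ?F N"
    and gh: "\<forall>x\<in>carrier ?F. g (h x) = f (\<pi> x)"
    using weighted_free_lift[OF N L _ g f\<pi>] by (auto simp: inj_def)
  show ?thesis
  proof (intro bexI ballI)
    show "(\<lambda>x. h (s x)) \<in> module_homs ?R P N" by (rule module_homs_comp[OF s h])
    show "g (h (s x)) = f x" if "x \<in> carrier P" for x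
      using gh module_homs_closed[OF s that] \<pi>s that by simp
  qed
qed

section \<open>Comparison maps and homotopies between projective resolutions\<close>

lemma projective_resolutionD:
  assumes "projective_resolution R M P d e"
  shows "projective_module R (P i)" "module R (P i)"
    "e \<in> module_homs R (P 0) M" "d i \<in> module_homs R (P (Suc i)) (P i)"
    "e ` carrier (P 0) = carrier M"
    "x \<in> carrier (P 0) \<Longrightarrow> e x = \<zero>\<^bsub>M\<^esub> \<longleftrightarrow> x \<in> d 0 ` carrier (P (Suc 0))"
    "x \<in> carrier (P (Suc i)) \<Longrightarrow>
      d i x = \<zero>\<^bsub>P i\<^esub> \<longleftrightarrow> x \<in> d (Suc i) ` carrier (P (Suc (Suc i)))"
    "d i ` carrier (P (Suc i)) \<subseteq> carrier (P i)"
proof -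
  show d: "d i \<in> module_homs R (P (Suc i)) (P i)"
    using assms by (auto simp: projective_resolution_def)
  show "d i ` carrier (P (Suc i)) \<subseteq> carrier (P i)"
    using module_homs_closed[OF d] by blast
qed (use assms in \<open>auto simp: projective_resolution_def projective_module_def\<close>)

text \<open>The classical comparison theorem: \<open>f (Suc i)\<close> lifts the composite of
  \<open>d i\<close> and \<open>f i\<close> along \<open>d' i\<close>, and exactness of
  \<open>T\<close> puts that composite into the image of \<open>d' i\<close>.\<close>

lemma projective_resolution_comparison:
  fixes P :: "nat \<Rightarrow> ('a :: comm_ring_1, 'p) module" and T :: "nat \<Rightarrow> ('a, 't) module"
  assumes M: "module ring_of_type_algebra M"
    and P: "projective_resolution ring_of_type_algebra M P d e"
    and T: "projective_resolution ring_of_type_algebra M T d' e'"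
  shows "\<exists>f. (\<forall>i. f i \<in> module_homs ring_of_type_algebra (P i) (T i)) \<and>
    (\<forall>x \<in> carrier (P 0). e' (f 0 x) = e x) \<and>
    (\<forall>i. \<forall>x \<in> carrier (P (Suc i)). d' i (f (Suc i) x) = f i (d i x))"
proof -
  let ?R = "ring_of_type_algebra :: 'a ring"
  note PD = projective_resolutionD[OF P] and TD = projective_resolutionD[OF T]
  \<comment> \<open>The invariant records that boundaries are sent to boundaries, which is the
    hypothesis of the next lift.\<close>
  let ?Inv = "\<lambda>i f. f \<in> module_homs ?R (P i) (T i) \<and>
    f ` (d i ` carrier (P (Suc i))) \<subseteq> d' i ` carrier (T (Suc i)) \<and>
    (i = 0 \<longrightarrow> (\<forall>x \<in> carrier (P 0). e' (f x) = e x))"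
  let ?Next = "\<lambda>i f f'. \<forall>x \<in> carrier (P (Suc i)). d' i (f' x) = f (d i x)"
  have "\<exists>f. \<forall>i. ?Inv i (f i) \<and> ?Next i (f i) (f (Suc i))"
  proof (rule dependent_nat_choice)
    obtain f where f: "f \<in> module_homs ?R (P 0) (T 0)"
      and ef: "\<forall>x \<in> carrier (P 0). e' (f x) = e x"
      using projective_module_lift[OF PD(1) TD(2) M TD(3) PD(3)] PD(5) TD(5) by auto
    have "f y \<in> d' 0 ` carrier (T (Suc 0))" if y: "y \<in> d 0 ` carrier (P (Suc 0))" for y
    proof -
      have y0: "y \<in> carrier (P 0)" using y PD(8) by blast
      then have "e y = \<zero>\<^bsub>M\<^esub>" using y PD(6) by blast
      then have "e' (f y) = \<zero>\<^bsub>M\<^esub>" using ef y0 by simp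
      then show ?thesis using TD(6)[OF module_homs_closed[OF f y0]] by simp
    qed
    with f ef have "?Inv 0 f" by blast
    then show "\<exists>f. ?Inv 0 f" by blast
  next
    fix f i assume Inv: "?Inv i f"
    have f: "f \<in> module_homs ?R (P i) (T i)" using Inv by blast
    have fd: "(\<lambda>x. f (d i x)) \<in> module_homs ?R (P (Suc i)) (T i)"
      by (rule module_homs_comp[OF PD(4) f])
    have "(\<lambda>x. f (d i x)) ` carrier (P (Suc i)) \<subseteq> d' i ` carrier (T (Suc i))"
      using Inv by blast
    from projective_module_lift[OF PD(1) TD(2) TD(2) TD(4) fd this]
    obtain f' where f': "f' \<in> module_homs ?R (P (Suc i)) (T (Suc i))"
      and nx: "?Next i f f'" by blast
    have "f' y \<in> d' (Suc i) ` carrier (T (Suc (Suc i)))"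
      if y: "y \<in> d (Suc i) ` carrier (P (Suc (Suc i)))" for y
    proof -
      have y0: "y \<in> carrier (P (Suc i))" using y PD(8) by blast
      then have "d i y = \<zero>\<^bsub>P i\<^esub>" using y PD(7) by blast
      then have "d' i (f' y) = \<zero>\<^bsub>T i\<^esub>"
        using nx y0 module_homs_zero[OF PD(2) TD(2) f] by simp
      then show ?thesis using TD(7)[OF module_homs_closed[OF f' y0]] by simp
    qed
    with f' have "?Inv (Suc i) f'" by blast
    with nx show "\<exists>f'. ?Inv (Suc i) f' \<and> ?Next i f f'" by blast
  qed
  then obtain f where "\<forall>i. ?Inv i (f i) \<and> ?Next i (f i) (f (Suc i))" by blast
  then show ?thesis by (intro exI[of _ f]) blast
qed

text \<open>The composite of the comparison maps to \<open>P\<close> and back is homotopic to the identity of \<open>T\<close>,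
  and it vanishes where \<open>P\<close> does.\<close>

lemma contracting_homotopy_beyond_length:
  fixes P :: "nat \<Rightarrow> ('a :: comm_ring_1, 'p) module" and T :: "nat \<Rightarrow> ('a, 't) module"
  assumes M: "module ring_of_type_algebra M"
    and P: "projective_resolution ring_of_type_algebra M P d e"
    and T: "projective_resolution ring_of_type_algebra M T d' e'"
    and trivial: "carrier (P (Suc i)) = {\<zero>\<^bsub>P (Suc i)\<^esub>}"
  shows "\<exists>s \<in> module_homs ring_of_type_algebra (T i) (T (Suc i)).
    \<exists>s' \<in> module_homs ring_of_type_algebra (T (Suc i)) (T (Suc (Suc i))).
    \<forall>x \<in> carrier (T (Suc i)). x = d' (Suc i) (s' x) \<oplus>\<^bsub>T (Suc i)\<^esub> s (d' i x)"
proof -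
  let ?R = "ring_of_type_algebra :: 'a ring"
  note PD = projective_resolutionD[OF P] and TD = projective_resolutionD[OF T]
  interpret T: module ?R "T j" for j by (rule TD(2))
  obtain f where f: "\<And>i. f i \<in> module_homs ?R (T i) (P i)"
    and ef: "\<And>x. x \<in> carrier (T 0) \<Longrightarrow> e (f 0 x) = e' x"
    and df: "\<And>i x. x \<in> carrier (T (Suc i)) \<Longrightarrow> d i (f (Suc i) x) = f i (d' i x)"
    using projective_resolution_comparison[OF M T P] by metis
  obtain g where g: "\<And>i. g i \<in> module_homs ?R (P i) (T i)"
    and eg: "\<And>x. x \<in> carrier (P 0) \<Longrightarrow> e' (g 0 x) = e x"
    and dg: "\<And>i x. x \<in> carrier (P (Suc i)) \<Longrightarrow> d' i (g (Suc i) x) = g i (d i x)"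
    using projective_resolution_comparison[OF M P T] by metis
  \<comment> \<open>Identity minus the round trip through \<open>P\<close>: a chain map that induces
    zero on \<open>M\<close>, hence is null-homotopic.\<close>
  define \<phi> where "\<phi> j x = x \<ominus>\<^bsub>T j\<^esub> g j (f j x)" for j x
  have \<phi>: "\<phi> j \<in> module_homs ?R (T j) (T j)" for j
    unfolding \<phi>_def
    by (rule module_homs_diff[OF TD(2) module_homs_ident module_homs_comp[OF f g]])
  have e\<phi>: "e' (\<phi> 0 x) = \<zero>\<^bsub>M\<^esub>" if x: "x \<in> carrier (T 0)" for x
  proof -
    have "e' (\<phi> 0 x) = e' x \<ominus>\<^bsub>M\<^esub> e' (g 0 (f 0 x))"
      unfolding \<phi>_def using x
      by (intro module_homs_minus[OF TD(2) M TD(3)]) (simp_all add: module_homs_closed[OF f]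
          module_homs_closed[OF g])
    also have "e' (g 0 (f 0 x)) = e' x"
      using x by (simp add: eg ef module_homs_closed[OF f])
    also have "e' x \<ominus>\<^bsub>M\<^esub> e' x = \<zero>\<^bsub>M\<^esub>"
      using abelian_group.r_neg[OF module.axioms(2)[OF M] module_homs_closed[OF TD(3) x]]
      by (simp add: a_minus_def)
    finally show ?thesis .
  qed
  have d\<phi>: "d' j (\<phi> (Suc j) x) = \<phi> j (d' j x)" if x: "x \<in> carrier (T (Suc j))" for j x
  proof -
    have "d' j (\<phi> (Suc j) x) = d' j x \<ominus>\<^bsub>T j\<^esub> d' j (g (Suc j) (f (Suc j) x))"
      unfolding \<phi>_def using x
      by (intro module_homs_minus[OF TD(2) TD(2) TD(4)]) (simp_all add: module_homs_closed[OF f]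
          module_homs_closed[OF g])
    then show ?thesis
      using x by (simp add: \<phi>_def dg df module_homs_closed[OF f])
  qed
  \<comment> \<open>On boundaries the homotopy term that starts with \<open>d'\<close> vanishes, so
    the homotopy equation reduces to \<open>d' j (s x) = \<phi> j x\<close>. This suffices to make
    the right-hand side of \<open>?Next\<close> a cycle.\<close>
  let ?Inv = "\<lambda>j s. s \<in> module_homs ?R (T j) (T (Suc j)) \<and>
    (\<forall>x \<in> d' j ` carrier (T (Suc j)). d' j (s x) = \<phi> j x)"
  let ?Next = "\<lambda>j s s'. \<forall>x \<in> carrier (T (Suc j)).
    d' (Suc j) (s' x) = \<phi> (Suc j) x \<ominus>\<^bsub>T (Suc j)\<^esub> s (d' j x)"
  have "\<exists>s. \<forall>j. ?Inv j (s j) \<and> ?Next j (s j) (s (Suc j))"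
  proof (rule dependent_nat_choice)
    have "\<phi> 0 ` carrier (T 0) \<subseteq> d' 0 ` carrier (T (Suc 0))"
      using e\<phi> TD(6)[OF module_homs_closed[OF \<phi>]] by blast
    from projective_module_lift[OF TD(1) TD(2) TD(2) TD(4) \<phi> this]
    obtain s where "s \<in> module_homs ?R (T 0) (T (Suc 0))" "\<forall>x \<in> carrier (T 0). d' 0 (s x) = \<phi> 0 x"
      by blast
    then have "?Inv 0 s" using TD(8) by blast
    then show "\<exists>s. ?Inv 0 s" by blast
  next
    fix s j assume Inv: "?Inv j s"
    then have s: "s \<in> module_homs ?R (T j) (T (Suc j))" by blast
    let ?\<psi> = "\<lambda>x. \<phi> (Suc j) x \<ominus>\<^bsub>T (Suc j)\<^esub> s (d' j x)"
    have \<psi>: "?\<psi> \<in> module_homs ?R (T (Suc j)) (T (Suc j))"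
      by (rule module_homs_diff[OF TD(2) \<phi> module_homs_comp[OF TD(4) s]])
    have "?\<psi> x \<in> d' (Suc j) ` carrier (T (Suc (Suc j)))" if x: "x \<in> carrier (T (Suc j))" for x
    proof -
      have dx: "d' j x \<in> carrier (T j)" by (rule module_homs_closed[OF TD(4) x])
      have "d' j (?\<psi> x) = d' j (\<phi> (Suc j) x) \<ominus>\<^bsub>T j\<^esub> d' j (s (d' j x))"
        by (rule module_homs_minus[OF TD(2) TD(2) TD(4) module_homs_closed[OF \<phi> x]
            module_homs_closed[OF s dx]])
      also have "\<dots> = \<zero>\<^bsub>T j\<^esub>"
        using Inv x T.r_neg[OF module_homs_closed[OF \<phi> dx]] by (simp add: d\<phi> a_minus_def)
      finally show ?thesis using TD(7)[OF module_homs_closed[OF \<psi> x]] by simp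
    qed
    then have "?\<psi> ` carrier (T (Suc j)) \<subseteq> d' (Suc j) ` carrier (T (Suc (Suc j)))" by blast
    from projective_module_lift[OF TD(1) TD(2) TD(2) TD(4) \<psi> this]
    obtain s' where s': "s' \<in> module_homs ?R (T (Suc j)) (T (Suc (Suc j)))"
      and nx: "?Next j s s'" by blast
    have "d' (Suc j) (s' x) = \<phi> (Suc j) x" if x: "x \<in> d' (Suc j) ` carrier (T (Suc (Suc j)))" for x
    proof -
      have x0: "x \<in> carrier (T (Suc j))" using x TD(8) by blast
      then have "d' j x = \<zero>\<^bsub>T j\<^esub>" using x TD(7) by blast
      then have "d' (Suc j) (s' x) = \<phi> (Suc j) x \<ominus>\<^bsub>T (Suc j)\<^esub> \<zero>\<^bsub>T (Suc j)\<^esub>"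
        using nx x0 module_homs_zero[OF TD(2) TD(2) s] by simp
      then show ?thesis using module_homs_closed[OF \<phi> x0] by (simp add: a_minus_def)
    qed
    with s' nx show "\<exists>s'. ?Inv (Suc j) s' \<and> ?Next j s s'" by blast
  qed
  then obtain s where s: "\<And>j. s j \<in> module_homs ?R (T j) (T (Suc j))"
    and nx: "\<And>j x. x \<in> carrier (T (Suc j)) \<Longrightarrow>
      d' (Suc j) (s (Suc j) x) = \<phi> (Suc j) x \<ominus>\<^bsub>T (Suc j)\<^esub> s j (d' j x)"
    by blast
  have "x = d' (Suc i) (s (Suc i) x) \<oplus>\<^bsub>T (Suc i)\<^esub> s i (d' i x)" if x: "x \<in> carrier (T (Suc i))"
      for x
  proof -
    have sx: "s i (d' i x) \<in> carrier (T (Suc i))"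
      by (rule module_homs_closed[OF s module_homs_closed[OF TD(4) x]])
    \<comment> \<open>\<open>P\<close> is zero in this degree, so \<open>\<phi>\<close> is the
      identity here and the homotopy equation becomes the claim.\<close>
    have "f (Suc i) x = \<zero>\<^bsub>P (Suc i)\<^esub>" using module_homs_closed[OF f x] trivial by simp
    then have "\<phi> (Suc i) x = x"
      using x module_homs_zero[OF PD(2) TD(2) g] by (simp add: \<phi>_def a_minus_def)
    then have "d' (Suc i) (s (Suc i) x) \<oplus>\<^bsub>T (Suc i)\<^esub> s i (d' i x) =
        x \<ominus>\<^bsub>T (Suc i)\<^esub> s i (d' i x) \<oplus>\<^bsub>T (Suc i)\<^esub> s i (d' i x)"
      by (simp add: nx[OF x])
    also have "\<dots> = x" using x sx by (simp add: a_minus_def T.a_assoc T.l_neg)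
    finally show ?thesis by simp
  qed
  with s show ?thesis by blast
qed


section \<open>Squarefree monomials\<close>

lemma lookup_monomial_mult:
  fixes p :: "('n \<Rightarrow>\<^sub>0 nat) \<Rightarrow>\<^sub>0 'k :: comm_ring_1"
  shows "Poly_Mapping.lookup (Poly_Mapping.single a 1 * p) (a + b) = Poly_Mapping.lookup p b"
proof -
  have "Poly_Mapping.lookup (Poly_Mapping.single a 1 * p) (a + b) =
      (\<Sum>l. (1 when a = l) * (\<Sum>q. Poly_Mapping.lookup p q when a + b = l + q))"
    by (simp add: lookup_mult lookup_single)
  also have "\<dots> = (\<Sum>l. (\<Sum>q. Poly_Mapping.lookup p q when a + b = l + q) when a = l)"
    by (simp add: when_mult)
  also have "\<dots> = (\<Sum>q. Poly_Mapping.lookup p q when a + b = a + q)"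
    by simp
  also have "\<dots> = Poly_Mapping.lookup p b"
    by simp
  finally show ?thesis .
qed

lemma inj_monomial_mult:
  "inj ((*) (Poly_Mapping.single a 1 :: ('n \<Rightarrow>\<^sub>0 nat) \<Rightarrow>\<^sub>0 'k :: comm_ring_1))"
  by (rule injI, rule poly_mapping_eqI) (metis lookup_monomial_mult)

lemma keys_monomial_mult:
  fixes p :: "('n \<Rightarrow>\<^sub>0 nat) \<Rightarrow>\<^sub>0 'k :: comm_ring_1"
  assumes "c \<in> Poly_Mapping.keys (Poly_Mapping.single a 1 * p)"
  shows "\<exists>b. c = a + b"
proof -
  have "c \<in> {a' + b | a' b. a' \<in> Poly_Mapping.keys (Poly_Mapping.single a 1 ::
      ('n \<Rightarrow>\<^sub>0 nat) \<Rightarrow>\<^sub>0 'k) \<and> b \<in> Poly_Mapping.keys p}"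
    using assms keys_mult by blast
  then show ?thesis by (auto split: if_splits)
qed

lemma monomial_dvd_iff:
  fixes p :: "('n \<Rightarrow>\<^sub>0 nat) \<Rightarrow>\<^sub>0 'k :: comm_ring_1"
  shows "Poly_Mapping.single a 1 dvd p \<longleftrightarrow> (\<forall>c \<in> Poly_Mapping.keys p. \<exists>b. c = a + b)"
proof
  assume "Poly_Mapping.single a 1 dvd p"
  then show "\<forall>c \<in> Poly_Mapping.keys p. \<exists>b. c = a + b"
    using keys_monomial_mult by (metis dvd_def)
next
  assume *: "\<forall>c \<in> Poly_Mapping.keys p. \<exists>b. c = a + b"
  let ?f = "\<lambda>b. Poly_Mapping.lookup p (a + b)"
  have "finite ((\<lambda>b. a + b) -` Poly_Mapping.keys p)"
    by (rule finite_vimageI) (auto simp: inj_def)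
  then have fin: "finite {b. ?f b \<noteq> 0}"
    by (simp add: vimage_def in_keys_iff)
  have "p = Poly_Mapping.single a 1 * Abs_poly_mapping ?f"
  proof (rule poly_mapping_eqI)
    fix c
    show "Poly_Mapping.lookup p c =
        Poly_Mapping.lookup (Poly_Mapping.single a 1 * Abs_poly_mapping ?f) c"
    proof (cases "\<exists>b. c = a + b")
      case True
      then show ?thesis using fin by (auto simp: lookup_monomial_mult)
    next
      case False
      then have "c \<notin> Poly_Mapping.keys p" "c \<notin> Poly_Mapping.keys (Poly_Mapping.single a 1 *
          Abs_poly_mapping ?f)"
        using * keys_monomial_mult by blast+
      then show ?thesis by (simp add: in_keys_iff)
    qed
  qed
  then show "Poly_Mapping.single a 1 dvd p" by (metis dvd_triv_left)
qed

definition squarefree_exponent :: "'n :: finite set \<Rightarrow> 'n \<Rightarrow>\<^sub>0 nat" where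
  "squarefree_exponent A = Abs_poly_mapping (\<lambda>i. if i \<in> A then 1 else 0)"

definition squarefree_monomial :: "'n :: finite set \<Rightarrow> ('n, 'k :: comm_ring_1) mpoly" where
  "squarefree_monomial A = Poly_Mapping.single (squarefree_exponent A) 1"

lemma lookup_squarefree_exponent [simp]:
  "Poly_Mapping.lookup (squarefree_exponent A) i = (if i \<in> A then 1 else 0)"
  by (simp add: squarefree_exponent_def)

lemma squarefree_exponent_decomp_iff:
  "(\<exists>b. c = squarefree_exponent A + b) \<longleftrightarrow> A \<subseteq> Poly_Mapping.keys c"
proof
  assume "A \<subseteq> Poly_Mapping.keys c"
  then have "c = squarefree_exponent A + (c - squarefree_exponent A)"
    by (intro poly_mapping_eqI) (auto simp: lookup_add lookup_minus in_keys_iff Suc_leI)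
  then show "\<exists>b. c = squarefree_exponent A + b" ..
qed (auto simp: in_keys_iff lookup_add)

text \<open>Divisibility by a squarefree monomial sees only the supports of exponent vectors, so the
  degrees of generators and faces can be handled as sets of variables.\<close>

lemma squarefree_monomial_dvd_iff:
  fixes p :: "('n :: finite, 'k :: comm_ring_1) mpoly"
  shows "squarefree_monomial A dvd p \<longleftrightarrow> (\<forall>c \<in> Poly_Mapping.keys p. A \<subseteq> Poly_Mapping.keys c)"
  by (simp add: squarefree_monomial_def monomial_dvd_iff squarefree_exponent_decomp_iff)

lemma keys_squarefree_exponent [simp]: "Poly_Mapping.keys (squarefree_exponent A) = A"
  by (auto simp: in_keys_iff split: if_splits)

lemma squarefree_monomial_dvd_mono:
  "A \<subseteq> A' \<Longrightarrow> (squarefree_monomial A :: ('n :: finite, 'k :: comm_ring_1) mpoly) dvd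
      squarefree_monomial A'"
  by (auto simp: squarefree_monomial_dvd_iff) (auto simp: squarefree_monomial_def split: if_splits)

lemma squarefree_monomial_insert:
  assumes "v \<notin> A"
  shows "squarefree_monomial (insert v A) = indeterminate v * squarefree_monomial A"
proof -
  have "squarefree_exponent (insert v A) = Poly_Mapping.single v 1 + squarefree_exponent A"
    using assms by (intro poly_mapping_eqI) (auto simp: lookup_add lookup_single when_def)
  then show ?thesis
    by (simp add: squarefree_monomial_def indeterminate_def mult_single)
qed

lemma indeterminate_dvd_squarefree_monomial_iff:
  "indeterminate v dvd (squarefree_monomial A :: ('n :: finite, 'k :: comm_ring_1) mpoly) \<longleftrightarrow> v \<in> A"
proof -
  have "Poly_Mapping.single v 1 = squarefree_exponent {v}"
    by (intro poly_mapping_eqI) (auto simp: lookup_single when_def)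
  then have "indeterminate v = (squarefree_monomial {v} :: ('n, 'k) mpoly)"
    by (simp add: indeterminate_def squarefree_monomial_def)
  then show ?thesis
    by (auto simp: squarefree_monomial_dvd_iff) (auto simp: squarefree_monomial_def)
qed

text \<open>Detects multiples of a variable: dividing by the monomial of \<open>A\<close> leaves
  \<open>indeterminate v\<close> times a polynomial, whose constant coefficient is zero.\<close>

lemma lookup_indeterminate_mult_eq_0:
  fixes p :: "('n :: finite, 'k :: comm_ring_1) mpoly"
  assumes "squarefree_monomial A dvd p"
  shows "Poly_Mapping.lookup (indeterminate v * p) (squarefree_exponent A) = 0"
proof -
  obtain q where q: "p = Poly_Mapping.single (squarefree_exponent A) 1 * q"
    using assms by (auto simp: dvd_def squarefree_monomial_def)
  have "Poly_Mapping.lookup (indeterminate v * p) (squarefree_exponent A + 0) =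
      Poly_Mapping.lookup (indeterminate v * q) 0"
    unfolding q mult.left_commute[of "indeterminate v"] by (rule lookup_monomial_mult)
  moreover have "0 \<notin> Poly_Mapping.keys (indeterminate v * q)"
  proof
    assume "0 \<in> Poly_Mapping.keys (indeterminate v * q)"
    then obtain b where "0 = Poly_Mapping.single v (1 :: nat) + b"
      unfolding indeterminate_def by (auto dest: keys_monomial_mult)
    then have "Poly_Mapping.lookup 0 v = Poly_Mapping.lookup (Poly_Mapping.single v (1 :: nat) +
        b) v"
      by simp
    then show False by (simp add: lookup_add)
  qed
  ultimately show ?thesis by (simp add: in_keys_iff)
qed

section \<open>Ideals generated by monomials\<close>

lemma poly_mapping_sum_singles:
  "p = (\<Sum>a \<in> Poly_Mapping.keys p. Poly_Mapping.single a (Poly_Mapping.lookup p a))"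
  by (rule poly_mapping_eqI) (simp add: lookup_sum lookup_single when_def in_keys_iff)

lemma a_inv_type_ring [simp]: "\<ominus>\<^bsub>ring_of_type_algebra\<^esub> x = - (x :: 'a :: comm_ring_1)"
proof -
  interpret cring "ring_of_type_algebra :: 'a ring" by (rule cring_from_type_algebra)
  show ?thesis using minus_equality[of "- x" x] by simp
qed

lemma ideal_type_ringI:
  fixes J :: "'a :: comm_ring_1 set"
  assumes "0 \<in> J" "\<And>x y. x \<in> J \<Longrightarrow> y \<in> J \<Longrightarrow> x + y \<in> J" "\<And>r x. x \<in> J \<Longrightarrow> r * x \<in> J"
  shows "ideal J ring_of_type_algebra"
proof -
  interpret cring "ring_of_type_algebra :: 'a ring" by (rule cring_from_type_algebra)
  have "- x \<in> J" if "x \<in> J" for x using assms(3)[OF that, of "- 1"] by simp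
  then have "subgroup J (add_monoid ring_of_type_algebra)"
    using assms(1,2) by (intro add.subgroupI) (auto simp flip: a_inv_def)
  then show ?thesis
    using assms(3) by (intro idealI ring_axioms) (auto simp: mult.commute)
qed

lemma ideal_type_ringD:
  fixes J :: "'a :: comm_ring_1 set"
  assumes "ideal J ring_of_type_algebra"
  shows "0 \<in> J" "x \<in> J \<Longrightarrow> y \<in> J \<Longrightarrow> x + y \<in> J" "x \<in> J \<Longrightarrow> r * x \<in> J"
proof -
  interpret ideal J ring_of_type_algebra by fact
  show "0 \<in> J" using additive_subgroup.zero_closed[OF is_additive_subgroup] by simp
  show "x \<in> J \<Longrightarrow> y \<in> J \<Longrightarrow> x + y \<in> J"
      using additive_subgroup.a_closed[OF is_additive_subgroup, of x y] by simp
  show "x \<in> J \<Longrightarrow> r * x \<in> J" using I_l_closed[of x r] by simp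
qed

lemma ideal_type_ring_sum:
  fixes J :: "'a :: comm_ring_1 set"
  assumes "ideal J ring_of_type_algebra" "\<And>c. c \<in> C \<Longrightarrow> f c \<in> J"
  shows "sum f C \<in> J"
  using assms(2)
  by (induction C rule: infinite_finite_induct) (simp_all add: ideal_type_ringD[OF assms(1)])

text \<open>Every exponent of \<open>r * p\<close> adds something to an exponent of
  \<open>p\<close>, so the right-hand side is an ideal; conversely each single term of its elements
  is a multiple of a generator.\<close>

lemma Idl_monomials:
  fixes E :: "('n \<Rightarrow>\<^sub>0 nat) set"
  shows "Idl\<^bsub>ring_of_type_algebra\<^esub> ((\<lambda>a. Poly_Mapping.single a 1) ` E) =
    {p :: ('n, 'k :: comm_ring_1) mpoly. \<forall>c \<in> Poly_Mapping.keys p. \<exists>a \<in> E. \<exists>b. c = a + b}"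
    (is "Idl\<^bsub>?R\<^esub> ?G = ?J")
proof -
  interpret cring ?R by (rule cring_from_type_algebra)
  have J: "ideal ?J ?R"
  proof (rule ideal_type_ringI)
    fix p q :: "('n, 'k) mpoly" assume "p \<in> ?J" "q \<in> ?J"
    then show "p + q \<in> ?J" using keys_add[of p q] by blast
  next
    fix r p :: "('n, 'k) mpoly" assume p: "p \<in> ?J"
    have "\<exists>a\<in>E. \<exists>b. c = a + b" if "c \<in> Poly_Mapping.keys (r * p)" for c
    proof -
      from that obtain c' c'' where "c = c' + c''" "c'' \<in> Poly_Mapping.keys p"
        using keys_mult[of r p] by blast
      moreover then obtain a b where "a \<in> E" "c'' = a + b" using p by blast
      ultimately have "c = a + (c' + b)" by (simp add: ac_simps)
      then show ?thesis using \<open>a \<in> E\<close> by blast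
    qed
    then show "r * p \<in> ?J" by simp
  qed simp
  have G: "?G \<subseteq> carrier ?R" by simp
  have "?G \<subseteq> ?J"
  proof
    fix p assume "p \<in> ?G"
    then obtain a where a: "a \<in> E" "p = Poly_Mapping.single a 1" by blast
    have "\<exists>a'\<in>E. \<exists>b. a = a' + b"
      using a(1) by (intro bexI[of _ a] exI[of _ 0]) auto
    then show "p \<in> ?J" by (simp add: a(2))
  qed
  then have "Idl\<^bsub>?R\<^esub> ?G \<subseteq> ?J" by (rule genideal_minimal[OF J])
  moreover have "?J \<subseteq> Idl\<^bsub>?R\<^esub> ?G"
  proof
    fix p assume p: "p \<in> ?J"
    note I = ideal_type_ringD[OF genideal_ideal[OF G]]
    have "Poly_Mapping.single c (Poly_Mapping.lookup p c) \<in> Idl\<^bsub>?R\<^esub> ?G"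
      if "c \<in> Poly_Mapping.keys p" for c
    proof -
      from bspec[OF CollectD[OF p] that] obtain a b where ab: "a \<in> E" "c = a + b"
        by (elim bexE exE)
      have "Poly_Mapping.single b (Poly_Mapping.lookup p c) * Poly_Mapping.single a 1 \<in> Idl\<^bsub>?R\<^esub> ?G"
        by (rule I(3)[OF subsetD[OF genideal_self[OF G] imageI[OF ab(1)]]])
      then show ?thesis unfolding ab(2) by (simp add: mult_single add.commute[of b])
    qed
    then have "(\<Sum>c\<in>Poly_Mapping.keys p. Poly_Mapping.single c (Poly_Mapping.lookup p c)) \<in>
        Idl\<^bsub>?R\<^esub> ?G"
      by (intro ideal_type_ring_sum[OF genideal_ideal[OF G]])
    then show "p \<in> Idl\<^bsub>?R\<^esub> ?G" by (subst poly_mapping_sum_singles[of p])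
  qed
  ultimately show ?thesis by blast
qed

text \<open>The exponent \<open>a\<close> of a minimal generator is divisible by an exponent
  \<open>e\<close> from a squarefree generating set, and \<open>e\<close> by an exponent
  \<open>f\<close> from \<open>G\<close>. Minimality forces \<open>f = a\<close>, hence
  \<open>a = e\<close>.\<close>

lemma minimal_generators_squarefree:
  fixes I :: "('n :: finite, 'k :: comm_ring_1) mpoly set"
  assumes I: "squarefree_monomial_ideal I" and G: "minimal_monomial_generators I G"
    and g: "g \<in> G"
  shows "\<exists>A. g = squarefree_monomial A"
proof -
  let ?m = "\<lambda>a. Poly_Mapping.single a 1 :: ('n, 'k) mpoly"
  have inj: "inj ?m"
    by (rule injI) (metis keys_single one_neq_zero singleton_inject)
  obtain S where S: "S \<subseteq> squarefree_monomials" "I = Idl\<^bsub>ring_of_type_algebra\<^esub> S"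
    using I by (auto simp: squarefree_monomial_ideal_def)
  define E where "E = {a. ?m a \<in> S}"
  define F where "F = {a. ?m a \<in> G}"
  have E: "S = ?m ` E" using S(1) by (auto simp: E_def squarefree_monomials_def)
  have F: "G = ?m ` F" using G by (auto simp: F_def minimal_monomial_generators_def monomials_def)
  have IE: "I = {p. \<forall>c \<in> Poly_Mapping.keys p. \<exists>a \<in> E. \<exists>b. c = a + b}"
    unfolding S(2) E by (rule Idl_monomials)
  have IF: "I = {p. \<forall>c \<in> Poly_Mapping.keys p. \<exists>a \<in> F. \<exists>b. c = a + b}"
    using G Idl_monomials[of F, where 'k = 'k] by (simp add: minimal_monomial_generators_def F)
  have in_I: "?m a \<in> I" if "a \<in> F \<union> E" for a
  proof -
    have self: "\<exists>a'\<in>S. \<exists>b. a = a' + b" if "a \<in> S" for S :: "('n \<Rightarrow>\<^sub>0 nat) set"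
      using that by (intro bexI[of _ a] exI[of _ 0]) auto
    from that show ?thesis
    proof
      assume "a \<in> E" then show ?thesis using self unfolding IE by simp
    next
      assume "a \<in> F" then show ?thesis using self unfolding IF by simp
    qed
  qed
  obtain a where a: "a \<in> F" "g = ?m a" using g F by auto
  obtain e b where e: "e \<in> E" "a = e + b"
    using in_I[of a] a unfolding IE by auto
  obtain f c where f: "f \<in> F" "e = f + c"
    using in_I[of e] e unfolding IF by auto
  \<comment> \<open>Otherwise \<open>f\<close> takes over everything that \<open>a\<close>
    generates, and \<open>G\<close> without the monomial of \<open>a\<close> would still generate
    \<open>I\<close>.\<close>
  have "f = a"
  proof (rule ccontr)
    assume "f \<noteq> a"
    then have fa: "f \<in> F - {a}" using f by blast
    have "Idl\<^bsub>ring_of_type_algebra\<^esub> (?m ` (F - {a})) = I"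
      unfolding Idl_monomials IF
    proof (intro Collect_cong ball_cong refl iffI)
      fix x assume "\<exists>a\<in>F. \<exists>b. x = a + b"
      then obtain h z where h: "h \<in> F" "x = h + z" by blast
      show "\<exists>a\<in>F - {a}. \<exists>b. x = a + b"
      proof (cases "h = a")
        case True
        then have "x = f + (c + b + z)" using h e f by (simp add: ac_simps)
        then show ?thesis using fa by blast
      qed (use h in blast)
    qed blast
    moreover have "?m ` (F - {a}) \<subset> G"
      using a(1) inj_image_eq_iff[OF inj, of "F - {a}" F] unfolding F by blast
    ultimately show False using G by (auto simp: minimal_monomial_generators_def)
  qed
  then have "a + (c + b) = a + 0" using e f by (simp add: ac_simps)
  then have "c + b = 0" by (rule add_left_imp_eq)
  have "Poly_Mapping.lookup b i = 0" for i
    using arg_cong[OF \<open>c + b = 0\<close>, of "\<lambda>x. Poly_Mapping.lookup x i"] by (simp add: lookup_add)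
  then have "b = 0" by (intro poly_mapping_eqI) simp
  then have "?m a \<in> S" using e by (simp add: E_def)
  then obtain a' where "?m a = ?m a'" "\<forall>i. Poly_Mapping.lookup a' i \<le> 1"
    using S(1) by (auto simp: squarefree_monomials_def)
  then have "\<forall>i. Poly_Mapping.lookup a i \<le> 1" using injD[OF inj] by blast
  then have "a = squarefree_exponent (Poly_Mapping.keys a)"
    by (intro poly_mapping_eqI) (metis in_keys_iff le_neq_implies_less less_one
        lookup_squarefree_exponent)
  then show ?thesis using a(2) unfolding squarefree_monomial_def by metis
qed

lemma squarefree_ideal_representation:
  fixes I :: "('n :: finite, 'k :: comm_ring_1) mpoly set"
  assumes "squarefree_monomial_ideal I" and "minimal_monomial_generators I (m ` V)"
  shows "\<exists>A. (\<forall>j\<in>V. m j = squarefree_monomial (A j)) \<and>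
    I = {p. \<forall>c \<in> Poly_Mapping.keys p. \<exists>j\<in>V. A j \<subseteq> Poly_Mapping.keys c}"
proof -
  have "\<forall>j\<in>V. \<exists>A. m j = squarefree_monomial A"
    using minimal_generators_squarefree[OF assms] by blast
  then obtain A where A: "\<forall>j\<in>V. m j = squarefree_monomial (A j)"
    by metis
  have "m ` V = (\<lambda>a. Poly_Mapping.single a 1) ` ((\<lambda>j. squarefree_exponent (A j)) ` V)"
    unfolding image_image by (rule image_cong[OF refl]) (simp add: A squarefree_monomial_def)
  then have "I = Idl\<^bsub>ring_of_type_algebra\<^esub> ((\<lambda>a. Poly_Mapping.single a 1) ` ((\<lambda>j.
      squarefree_exponent (A j)) ` V))"
    using assms(2) by (simp add: minimal_monomial_generators_def)
  then have "I = {p. \<forall>c \<in> Poly_Mapping.keys p. \<exists>j\<in>V. A j \<subseteq> Poly_Mapping.keys c}"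
    unfolding Idl_monomials by (simp add: squarefree_exponent_decomp_iff)
  with A show ?thesis by blast
qed


section \<open>The Taylor resolution\<close>

lemma module_quotient_module:
  assumes "ideal I R" "cring R"
  shows "module R (quotient_module R I)"
proof -
  interpret I: ideal I R by fact
  interpret R: cring R by fact
  interpret Q: cring "R Quot I" by (rule I.quotient_is_cring[OF assms(2)])
  interpret h: ring_hom_ring R "R Quot I" "(+>\<^bsub>R\<^esub>) I" by (rule I.rcos_ring_hom_ring)
  have "abelian_group (quotient_module R I)"
  proof (rule abelian_groupI)
    fix x assume "x \<in> carrier (quotient_module R I)"
    then show "\<exists>y\<in>carrier (quotient_module R I). y \<oplus>\<^bsub>quotient_module R I\<^esub> x =
        \<zero>\<^bsub>quotient_module R I\<^esub>"
      by (intro bexI[of _ "\<ominus>\<^bsub>R Quot I\<^esub> x"]) (auto simp: quotient_module_def Q.l_neg)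
  qed (auto simp: quotient_module_def Q.a_ac)
  then show ?thesis
    by (intro moduleI assms(2)) (auto simp: quotient_module_def Q.l_distr Q.r_distr Q.m_assoc)
qed

lemma a_r_coset_eq_iff_mem:
  assumes "ideal I R" "x \<in> carrier R"
  shows "I +>\<^bsub>R\<^esub> x = I \<longleftrightarrow> x \<in> I"
  using ideal.rcos_const_imp_mem[OF assms] ring.a_rcos_zero[OF ideal.axioms(2)[OF assms(1)]
      assms(1)] by auto

definition faces :: "nat set \<Rightarrow> nat \<Rightarrow> nat set set" where
  "faces V k = {\<sigma>. \<sigma> \<subseteq> V \<and> card \<sigma> = k}"

text \<open>The exponent is the position at which \<open>i\<close> is inserted into the increasingly
  ordered vertices of \<open>\<sigma>\<close>.\<close>

definition incidence_sign :: "nat \<Rightarrow> nat set \<Rightarrow> 'a :: comm_ring_1" where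
  "incidence_sign i \<sigma> = (- 1) ^ card {l \<in> \<sigma>. l < i}"

text \<open>The oriented simplicial differential, given by its coefficients at the target instead of
  on basis elements. The zero clause confines the result to chains on \<open>V\<close>.\<close>

definition boundary :: "nat set \<Rightarrow> (nat set \<Rightarrow> 'a :: comm_ring_1) \<Rightarrow> nat set \<Rightarrow> 'a" where
  "boundary V y \<tau> = (if \<tau> \<subseteq> V then \<Sum>i\<in>V - \<tau>. incidence_sign i \<tau> * y (insert i \<tau>) else 0)"

text \<open>The weight is the lcm of the generators in \<open>\<sigma>\<close>, which is the
  multidegree of the Taylor basis element of \<open>\<sigma>\<close>.\<close>

definition taylor_module ::
    "(nat \<Rightarrow> 'n :: finite set) \<Rightarrow> nat set set \<Rightarrow> (('n, 'k ::
        comm_ring_1) mpoly, nat set \<Rightarrow> ('n, 'k) mpoly) module" where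
  "taylor_module A J = weighted_free_module J (\<lambda>\<sigma>. squarefree_monomial (\<Union>(A ` \<sigma>)))"

lemma taylor_module_carrier_iff:
  assumes "finite J"
  shows "y \<in> carrier (taylor_module A J) \<longleftrightarrow>
    (\<forall>\<sigma>. (\<sigma> \<notin> J \<longrightarrow> y \<sigma> = 0) \<and> squarefree_monomial (\<Union>(A ` \<sigma>)) dvd y \<sigma>)"
  unfolding taylor_module_def weighted_free_simps
  using finite_subset[OF _ assms, of "{\<sigma>. y \<sigma> \<noteq> 0}"] by blast

lemma taylor_module_ops [simp]:
  "\<zero>\<^bsub>taylor_module A J\<^esub> = (\<lambda>_. 0)"
  "x \<oplus>\<^bsub>taylor_module A J\<^esub> y = (\<lambda>t. x t + y t)"
  "r \<odot>\<^bsub>taylor_module A J\<^esub> x = (\<lambda>t. r * x t)"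
  by (simp_all add: taylor_module_def)

lemma projective_taylor_module:
  "projective_module ring_of_type_algebra (taylor_module A J)"
  unfolding taylor_module_def
  by (rule projective_weighted_free) (simp add: squarefree_monomial_def inj_monomial_mult)

lemma finite_faces: "finite V \<Longrightarrow> finite (faces V k)"
  by (auto simp: faces_def)

lemma incidence_sign_insert:
  assumes "finite \<tau>" "i \<notin> \<tau>"
  shows "incidence_sign j (insert i \<tau>) = (if i < j then - 1 else 1) * incidence_sign j \<tau>"
proof (cases "i < j")
  case True
  then have "{l \<in> insert i \<tau>. l < j} = insert i {l \<in> \<tau>. l < j}" by auto
  then show ?thesis using assms True by (simp add: incidence_sign_def)
next
  case False
  then have "{l \<in> insert i \<tau>. l < j} = {l \<in> \<tau>. l < j}" by auto
  then show ?thesis using False by (simp add: incidence_sign_def)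
qed

lemma incidence_sign_square [simp]: "incidence_sign i \<sigma> * incidence_sign i \<sigma> = 1"
  by (simp add: incidence_sign_def flip: power_add mult_2)

lemma incidence_sign_antisym:
  assumes "finite \<tau>" "i \<notin> \<tau>" "j \<notin> \<tau>" "i \<noteq> j"
  shows "incidence_sign i \<tau> * incidence_sign j (insert i \<tau>) =
    - (incidence_sign j \<tau> * incidence_sign i (insert j \<tau>))"
  using assms by (auto simp: incidence_sign_insert not_less_iff_gr_or_eq)

lemma lookup_incidence_sign_mult:
  "Poly_Mapping.lookup (incidence_sign i \<sigma> * p) c =
    incidence_sign i \<sigma> * Poly_Mapping.lookup (p :: ('n, 'k :: comm_ring_1) mpoly) c"
  by (cases "even (card {l \<in> \<sigma>. l < i})") (simp_all add: incidence_sign_def)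

text \<open>Exchanging \<open>i\<close> and \<open>j\<close> in the whole sum would only show that
  twice the sum vanishes. The induction on \<open>S\<close> cancels the pairs one by one and so
  covers characteristic two.\<close>

lemma sum_antisymmetric_eq_0:
  fixes f :: "nat \<Rightarrow> nat \<Rightarrow> 'a :: ab_group_add"
  assumes "finite S" "\<And>i j. i \<in> S \<Longrightarrow> j \<in> S \<Longrightarrow> i \<noteq> j \<Longrightarrow> f i j = - f j i"
  shows "(\<Sum>i\<in>S. \<Sum>j\<in>S - {i}. f i j) = 0"
  using assms
proof (induction S rule: finite_induct)
  case (insert s S)
  have "insert s S - {i} = insert s (S - {i})" if "i \<in> S" for i
    using that insert.hyps by auto
  moreover have "insert s S - {s} = S" using insert.hyps by auto
  ultimately have "(\<Sum>i\<in>insert s S. \<Sum>j\<in>insert s S - {i}. f i j) =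
      (\<Sum>j\<in>S. f s j) + (\<Sum>i\<in>S. \<Sum>j\<in>insert s (S - {i}). f i j)"
    using insert.hyps by simp
  also have "(\<Sum>i\<in>S. \<Sum>j\<in>insert s (S - {i}). f i j) = (\<Sum>i\<in>S. f i s + (\<Sum>j\<in>S - {i}. f i j))"
    using insert.hyps by (intro sum.cong refl sum.insert) auto
  also have "\<dots> = (\<Sum>i\<in>S. f i s)"
    using insert.IH[OF insert.prems] by (simp add: sum.distrib)
  also have "\<dots> = (\<Sum>i\<in>S. - f s i)"
    using insert.hyps by (intro sum.cong refl insert.prems) auto
  finally show ?case unfolding sum_negf by simp
qed simp

lemma boundary_boundary:
  fixes y :: "nat set \<Rightarrow> 'a :: comm_ring_1"
  assumes "finite V"
  shows "boundary V (boundary V y) = (\<lambda>_. 0)"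
proof
  fix \<tau>
  show "boundary V (boundary V y) \<tau> = 0"
  proof (cases "\<tau> \<subseteq> V")
    case True
    then have fin: "finite \<tau>" using assms finite_subset by blast
    let ?f = "\<lambda>i j. incidence_sign i \<tau> * incidence_sign j (insert i \<tau>) * y (insert j (insert i \<tau>))"
    have "boundary V (boundary V y) \<tau> = (\<Sum>i\<in>V - \<tau>. \<Sum>j\<in>V - \<tau> - {i}. ?f i j)"
      using True by (auto simp: boundary_def sum_distrib_left mult.assoc intro!: sum.cong)
    also have "\<dots> = 0"
    proof (rule sum_antisymmetric_eq_0)
      fix i j assume "i \<in> V - \<tau>" "j \<in> V - \<tau>" "i \<noteq> j"
      then show "?f i j = - ?f j i"
        using incidence_sign_antisym[OF fin, of i j, where 'a = 'a]
        by (simp add: insert_commute)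
    qed (use assms in simp)
    finally show ?thesis .
  qed (simp add: boundary_def)
qed

lemma boundary_add: "boundary V (\<lambda>\<sigma>. x \<sigma> + y \<sigma>) = (\<lambda>\<tau>. boundary V x \<tau> + boundary V y \<tau>)"
  by (rule ext) (simp add: boundary_def ring_distribs sum.distrib)

lemma boundary_smult: "boundary V (\<lambda>\<sigma>. r * x \<sigma>) = (\<lambda>\<tau>. r * boundary V x \<tau>)"
  by (rule ext) (simp add: boundary_def sum_distrib_left mult.left_commute)

lemma boundary_diff: "boundary V (\<lambda>\<sigma>. x \<sigma> - y \<sigma>) = (\<lambda>\<tau>. boundary V x \<tau> - boundary V y \<tau>)"
  by (rule ext) (simp add: boundary_def right_diff_distrib sum_subtractf)

lemma boundary_taylor_carrier:
  assumes V: "finite V" and y: "y \<in> carrier (taylor_module A (faces V (Suc k)))"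
  shows "boundary V y \<in> carrier (taylor_module A (faces V k))"
  unfolding taylor_module_carrier_iff[OF finite_faces[OF V]]
proof (intro allI conjI impI)
  note y' = y[unfolded taylor_module_carrier_iff[OF finite_faces[OF V]], rule_format]
  fix \<tau>
  show "squarefree_monomial (\<Union>(A ` \<tau>)) dvd boundary V y \<tau>"
  proof -
    have "squarefree_monomial (\<Union>(A ` \<tau>)) dvd y (insert i \<tau>)" for i
      by (rule dvd_trans[OF squarefree_monomial_dvd_mono y'[THEN conjunct2]]) auto
    then show ?thesis by (auto simp: boundary_def intro!: dvd_sum dvd_mult)
  qed
  assume \<tau>: "\<tau> \<notin> faces V k"
  show "boundary V y \<tau> = 0"
  proof (cases "\<tau> \<subseteq> V")
    case True
    then have "finite \<tau>" using V by (rule finite_subset)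
    with True have "insert i \<tau> \<notin> faces V (Suc k)" if "i \<in> V - \<tau>" for i
      using that \<tau> by (auto simp: faces_def)
    then show ?thesis using y' by (simp add: boundary_def)
  qed (simp add: boundary_def)
qed

lemma taylor_module_mono:
  "J \<subseteq> J' \<Longrightarrow> carrier (taylor_module A J) \<subseteq> carrier (taylor_module A J')"
  unfolding taylor_module_def by (rule subsetI) (simp, blast)

text \<open>The contraction is multigraded: in a degree \<open>c\<close> that lies in the ideal, adjoin to a face the
  least vertex whose generator divides the monomial of degree \<open>c\<close>. Faces with a nonzero
  coefficient in degree \<open>c\<close> have no smaller vertices, so the vertex enters with sign \<open>1\<close>.\<close>

lemma taylor_complex_exact:
  fixes y :: "nat set \<Rightarrow> ('n :: finite, 'k :: comm_ring_1) mpoly"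
  assumes V: "finite V" and y: "y \<in> carrier (taylor_module A (faces V k))"
    and cycle: "boundary V y = (\<lambda>_. 0)"
    and cover: "\<And>\<sigma> c. c \<in> Poly_Mapping.keys (y \<sigma>) \<Longrightarrow> \<exists>j\<in>V. A j \<subseteq> Poly_Mapping.keys c"
  shows "\<exists>z \<in> carrier (taylor_module A (faces V (Suc k))). boundary V z = y"
proof -
  note y' = y[unfolded taylor_module_carrier_iff[OF finite_faces[OF V]]
      squarefree_monomial_dvd_iff, rule_format]
  define P :: "('n \<Rightarrow>\<^sub>0 nat) \<Rightarrow> nat \<Rightarrow> bool" where "P c j \<longleftrightarrow> j \<in> V \<and> A j \<subseteq> Poly_Mapping.keys c" for c j
  define cov where "cov c \<longleftrightarrow> (\<exists>i. P c i)" for c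
  define j where "j c = (LEAST i. P c i)" for c
  have jP: "P c (j c)" if "cov c" for c
    using that unfolding j_def cov_def by (rule LeastI_ex)
  have j_le: "j c \<le> i" if "P c i" for c i
    using that unfolding j_def by (rule Least_le)
  have face: "P c i" if "c \<in> Poly_Mapping.keys (y \<sigma>)" "i \<in> \<sigma>" for c \<sigma> i
    using that y'[of \<sigma>] unfolding P_def faces_def
    by (cases "\<sigma> \<in> faces V k") (auto simp: faces_def)
  have sign_1: "incidence_sign (j c) \<sigma> = (1 :: 'k)"
    if "c \<in> Poly_Mapping.keys (y \<tau>)" "\<sigma> \<subseteq> \<tau>" for c \<sigma> \<tau>
  proof -
    have "{l \<in> \<sigma>. l < j c} = {}" using face[OF that(1)] j_le that(2) by (auto simp: not_less)
    then show ?thesis by (simp only: incidence_sign_def) simp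
  qed
  define zc where "zc \<sigma> c = (if cov c \<and> j c \<in>
      \<sigma> then Poly_Mapping.lookup (y (\<sigma> - {j c})) c else 0)" for \<sigma> c
  define z where "z \<sigma> = Abs_poly_mapping (zc \<sigma>)" for \<sigma>
  have z_lookup: "Poly_Mapping.lookup (z \<sigma>) c = zc \<sigma> c" for \<sigma> c
  proof -
    have "{c. zc \<sigma> c \<noteq> 0} \<subseteq> (\<Union>i\<in>V. Poly_Mapping.keys (y (\<sigma> - {i})))"
    proof
      fix c assume "c \<in> {c. zc \<sigma> c \<noteq> 0}"
      then have "cov c" "c \<in> Poly_Mapping.keys (y (\<sigma> - {j c}))"
        by (auto simp: zc_def in_keys_iff split: if_splits)
      with jP[of c] show "c \<in> (\<Union>i\<in>V. Poly_Mapping.keys (y (\<sigma> - {i})))"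
        by (auto simp: P_def)
    qed
    then have "finite {c. zc \<sigma> c \<noteq> 0}"
      by (rule finite_subset) (use V in auto)
    then show ?thesis by (simp add: z_def)
  qed
  have z_keys: "cov c \<and> j c \<in> \<sigma> \<and> c \<in> Poly_Mapping.keys (y (\<sigma> - {j c}))"
    if "c \<in> Poly_Mapping.keys (z \<sigma>)" for c \<sigma>
    using that by (auto simp: in_keys_iff z_lookup zc_def split: if_splits)
  have z: "z \<in> carrier (taylor_module A (faces V (Suc k)))"
    unfolding taylor_module_carrier_iff[OF finite_faces[OF V]] squarefree_monomial_dvd_iff
  proof (intro allI conjI impI ballI)
    fix \<sigma> c assume "c \<in> Poly_Mapping.keys (z \<sigma>)"
    note zk = z_keys[OF this]
    show "\<Union>(A ` \<sigma>) \<subseteq> Poly_Mapping.keys c"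
    proof
      fix x assume "x \<in> \<Union>(A ` \<sigma>)"
      then obtain l where l: "l \<in> \<sigma>" "x \<in> A l" by blast
      have "P c l"
        using jP[of c] face[of c "\<sigma> - {j c}" l] zk l(1) by (cases "l = j c") simp_all
      then show "x \<in> Poly_Mapping.keys c" using l(2) by (auto simp: P_def)
    qed
  next
    fix \<sigma> assume \<sigma>: "\<sigma> \<notin> faces V (Suc k)"
    have False if "c \<in> Poly_Mapping.keys (z \<sigma>)" for c
    proof -
      note zk = z_keys[OF that]
      then have "\<sigma> - {j c} \<in> faces V k" using y'[of "\<sigma> - {j c}"] by (metis keys_zero empty_iff)
      moreover have "j c \<in> V" using jP zk by (auto simp: P_def)
      ultimately have "\<sigma> \<subseteq> V" "card (\<sigma> - {j c}) = k" by (auto simp: faces_def)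
      then have "card \<sigma> = Suc k"
        using zk V card_Suc_Diff1[of \<sigma> "j c"] finite_subset by metis
      with \<open>\<sigma> \<subseteq> V\<close> have "\<sigma> \<in> faces V (Suc k)" by (simp add: faces_def)
      with \<sigma> show False ..
    qed
    then have "Poly_Mapping.keys (z \<sigma>) = {}" by blast
    then show "z \<sigma> = 0" by (intro poly_mapping_eqI) (auto simp: in_keys_iff)
  qed
  have "boundary V z \<tau> = y \<tau>" for \<tau>
  proof (cases "\<tau> \<subseteq> V")
    case False
    then show ?thesis using y'[of \<tau>] by (auto simp: boundary_def faces_def)
  next
    case True
    then have fin: "finite \<tau>" using V finite_subset by blast
    show ?thesis
    proof (rule poly_mapping_eqI)
      fix c
      have lk: "Poly_Mapping.lookup (boundary V z \<tau>) c =
          (\<Sum>i\<in>V - \<tau>. incidence_sign i \<tau> * zc (insert i \<tau>) c)"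
        using True by (simp add: boundary_def lookup_sum lookup_incidence_sign_mult z_lookup)
      consider "\<not> cov c" | "cov c" "j c \<notin> \<tau>" | "cov c" "j c \<in> \<tau>" by blast
      then show "Poly_Mapping.lookup (boundary V z \<tau>) c = Poly_Mapping.lookup (y \<tau>) c"
      proof cases
        case 1
        then have "c \<notin> Poly_Mapping.keys (y \<tau>)" using cover[of c \<tau>] by (auto simp: P_def cov_def)
        then show ?thesis unfolding lk using 1 by (simp add: zc_def in_keys_iff)
      next
        case 2
        have jV: "j c \<in> V - \<tau>" using jP[OF 2(1)] 2(2) by (simp add: P_def)
        have "(\<Sum>i\<in>V - \<tau>. incidence_sign i \<tau> * zc (insert i \<tau>) c) =
            (\<Sum>i\<in>V - \<tau>. if i = j c then incidence_sign i \<tau> * zc (insert i \<tau>) c else 0)"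
          using 2 by (intro sum.cong) (auto simp: zc_def)
        also have "\<dots> = incidence_sign (j c) \<tau> * zc (insert (j c) \<tau>) c"
          using V jV by simp
        also have "\<dots> = incidence_sign (j c) \<tau> * Poly_Mapping.lookup (y \<tau>) c"
          using 2 by (auto simp: zc_def)
        also have "\<dots> = Poly_Mapping.lookup (y \<tau>) c"
          using sign_1[of c \<tau> \<tau>] by (cases "c \<in> Poly_Mapping.keys (y \<tau>)") (auto simp: in_keys_iff)
        finally show ?thesis unfolding lk .
      next
        case 3
        \<comment> \<open>Here \<open>\<tau>\<close> already contains the vertex that the
          contraction adjoins, so \<open>y \<tau>\<close> is none of the summands. It is recovered
          from the cycle condition at the smaller face \<open>\<rho>\<close>.\<close>
        define \<rho> where "\<rho> = \<tau> - {j c}"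
        have \<rho>: "\<tau> = insert (j c) \<rho>" "j c \<notin> \<rho>" "\<rho> \<subseteq> V" "finite \<rho>"
          using 3(2) True fin by (auto simp: \<rho>_def)
        have jV: "j c \<in> V" using jP[OF 3(1)] by (simp add: P_def)
        have set: "V - \<rho> = insert (j c) (V - \<tau>)" using jV \<rho> by auto
        have "0 = Poly_Mapping.lookup (boundary V y \<rho>) c" by (simp add: cycle)
        also have "\<dots> = (\<Sum>i\<in>V - \<rho>. incidence_sign i \<rho> * Poly_Mapping.lookup (y (insert i \<rho>)) c)"
          using \<rho>(3) by (simp add: boundary_def lookup_sum lookup_incidence_sign_mult)
        also have "\<dots> = incidence_sign (j c) \<rho> * Poly_Mapping.lookup (y \<tau>) c +
            (\<Sum>i\<in>V - \<tau>. incidence_sign i \<rho> * Poly_Mapping.lookup (y (insert i \<rho>)) c)"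
          unfolding set using V \<rho>(1) by (subst sum.insert) auto
        also have "incidence_sign (j c) \<rho> * Poly_Mapping.lookup (y \<tau>) c =
            Poly_Mapping.lookup (y \<tau>) c"
          using sign_1[of c \<tau> \<rho>] \<rho>(1) subset_insertI[of \<rho> "j c"]
          by (cases "c \<in> Poly_Mapping.keys (y \<tau>)") (auto simp: in_keys_iff)
        finally have 0: "(\<Sum>i\<in>V - \<tau>. incidence_sign i \<rho> * Poly_Mapping.lookup (y (insert i \<rho>)) c) =
            - Poly_Mapping.lookup (y \<tau>) c"
          by (simp add: eq_neg_iff_add_eq_0 add.commute)
        have "incidence_sign i \<tau> * zc (insert i \<tau>) c =
            - (incidence_sign i \<rho> * Poly_Mapping.lookup (y (insert i \<rho>)) c)" if i: "i \<in> V - \<tau>" for i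
        proof -
          have "insert i \<tau> - {j c} = insert i \<rho>" using i \<rho> by auto
          then have zc: "zc (insert i \<tau>) c = Poly_Mapping.lookup (y (insert i \<rho>)) c"
            using 3 by (simp add: zc_def)
          show ?thesis
          proof (cases "c \<in> Poly_Mapping.keys (y (insert i \<rho>))")
            case True
            have "j c \<le> i" using face[OF True] j_le by simp
            moreover have "j c \<noteq> i" using i 3(2) by blast
            \<comment> \<open>\<open>j c\<close> precedes \<open>i\<close>, so its presence in
              \<open>\<tau>\<close> shifts the position of \<open>i\<close> by one.\<close>
            ultimately have "incidence_sign i \<tau> = - (incidence_sign i \<rho> :: 'k)"
              unfolding \<rho>(1) using \<rho>(2,4) by (simp add: incidence_sign_insert)
            then show ?thesis by (simp add: zc)
          next
            case False
            then show ?thesis by (simp add: zc in_keys_iff)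
          qed
        qed
        then have "(\<Sum>i\<in>V - \<tau>. incidence_sign i \<tau> * zc (insert i \<tau>) c) =
            - (\<Sum>i\<in>V - \<tau>. incidence_sign i \<rho> * Poly_Mapping.lookup (y (insert i \<rho>)) c)"
          by (simp add: sum_negf)
        then show ?thesis unfolding lk 0 by simp
      qed
    qed
  qed
  with z show ?thesis by blast
qed

text \<open>On nonempty faces the covering condition is automatic: the generator of any vertex of
  the face divides the coefficient. It is a real condition only for the empty face.\<close>

lemma taylor_complex_exact_Suc:
  fixes y :: "nat set \<Rightarrow> ('n :: finite, 'k :: comm_ring_1) mpoly"
  assumes V: "finite V" and y: "y \<in> carrier (taylor_module A (faces V (Suc k)))"
    and cycle: "boundary V y = (\<lambda>_. 0)"
  shows "\<exists>z \<in> carrier (taylor_module A (faces V (Suc (Suc k)))). boundary V z = y"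
proof -
  note y' = y[unfolded taylor_module_carrier_iff[OF finite_faces[OF V]] squarefree_monomial_dvd_iff]
  have "\<exists>j\<in>V. A j \<subseteq> Poly_Mapping.keys c" if c: "c \<in> Poly_Mapping.keys (y \<sigma>)" for \<sigma> c
  proof -
    have "\<sigma> \<in> faces V (Suc k)" using y' c by force
    then have "\<sigma> \<subseteq> V" "\<sigma> \<noteq> {}" by (auto simp: faces_def)
    then obtain j where "j \<in> \<sigma>" "j \<in> V" by blast
    then show ?thesis using y' c by blast
  qed
  then show ?thesis using taylor_complex_exact[OF V y cycle] by blast
qed

text \<open>Copies a module along an injection, because the definition of projective dimension
  admits only resolutions carried by one prescribed type.\<close>

definition transported_module :: "('p \<Rightarrow> 'q) \<Rightarrow> ('a, 'p) module \<Rightarrow> ('a, 'q) module" where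
  "transported_module \<psi> P =
    \<lparr>carrier = \<psi> ` carrier P, monoid.mult = (\<lambda>_ _. undefined), one = undefined,
     ring.zero = \<psi> \<zero>\<^bsub>P\<^esub>,
     add = (\<lambda>x y. \<psi> (inv_into (carrier P) \<psi> x \<oplus>\<^bsub>P\<^esub> inv_into (carrier P) \<psi> y)),
     module.smult = (\<lambda>r x. \<psi> (r \<odot>\<^bsub>P\<^esub> inv_into (carrier P) \<psi> x))\<rparr>"

lemma transported_module_simps [simp]:
  "carrier (transported_module \<psi> P) = \<psi> ` carrier P"
  "\<zero>\<^bsub>transported_module \<psi> P\<^esub> = \<psi> \<zero>\<^bsub>P\<^esub>"
  "x \<oplus>\<^bsub>transported_module \<psi> P\<^esub> y =
    \<psi> (inv_into (carrier P) \<psi> x \<oplus>\<^bsub>P\<^esub> inv_into (carrier P) \<psi> y)"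
  "r \<odot>\<^bsub>transported_module \<psi> P\<^esub> x = \<psi> (r \<odot>\<^bsub>P\<^esub> inv_into (carrier P) \<psi> x)"
  by (simp_all add: transported_module_def)

lemma module_transported:
  assumes P: "module R P" and inj: "inj_on \<psi> (carrier P)"
  shows "module R (transported_module \<psi> P)"
proof -
  interpret P: module R P by fact
  note inv = inv_into_f_f[OF inj]
  have "abelian_group (transported_module \<psi> P)"
  proof (rule abelian_groupI)
    fix x assume "x \<in> carrier (transported_module \<psi> P)"
    then obtain x' where "x' \<in> carrier P" "x = \<psi> x'" by auto
    then show "\<exists>y\<in>carrier (transported_module \<psi> P).
        y \<oplus>\<^bsub>transported_module \<psi> P\<^esub> x = \<zero>\<^bsub>transported_module \<psi> P\<^esub>"
      by (intro bexI[of _ "\<psi> (\<ominus>\<^bsub>P\<^esub> x')"]) (simp_all add: inv P.l_neg)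
  qed (auto simp: inv P.a_ac)
  then show ?thesis
    by (intro moduleI P.cring_axioms)
      (auto simp: inv P.smult_l_distr P.smult_r_distr P.smult_assoc1)
qed

lemma transported_module_homs:
  assumes inj: "inj_on \<psi> (carrier P)" and P: "module R P"
  shows "\<psi> \<in> module_homs R P (transported_module \<psi> P)"
    and "inv_into (carrier P) \<psi> \<in> module_homs R (transported_module \<psi> P) P"
proof -
  interpret P: module R P by fact
  note inv = inv_into_f_f[OF inj]
  show "\<psi> \<in> module_homs R P (transported_module \<psi> P)"
    by (rule module_homsI) (simp_all add: inv)
  show "inv_into (carrier P) \<psi> \<in> module_homs R (transported_module \<psi> P) P"
    by (rule module_homsI) (auto simp: inv)
qed

text \<open>The test modules for the copy live on types built from \<open>'q\<close>, so the lifting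
  property of \<open>P\<close> is needed without its restriction on types.\<close>

lemma projective_transported:
  fixes P :: "('a :: comm_ring_1, 'p) module"
  assumes P: "projective_module ring_of_type_algebra P" and inj: "inj_on \<psi> (carrier P)"
  shows "projective_module ring_of_type_algebra (transported_module \<psi> P :: ('a, 'q) module)"
  unfolding projective_module_def
proof (intro conjI allI impI)
  have mP: "module ring_of_type_algebra P" using P by (simp add: projective_module_def)
  show "module ring_of_type_algebra (transported_module \<psi> P)"
      by (rule module_transported[OF mP inj])
  fix N :: "('a, 'q \<Rightarrow> 'a) module" and L :: "('a, 'q) module" and g f
  assume *: "module ring_of_type_algebra N" "module ring_of_type_algebra L"
    "g \<in> module_homs ring_of_type_algebra N L" "g ` carrier N = carrier L"
    "f \<in> module_homs ring_of_type_algebra (transported_module \<psi> P) L"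
  have f\<psi>: "(\<lambda>x. f (\<psi> x)) \<in> module_homs ring_of_type_algebra P L"
    by (rule module_homs_comp[OF transported_module_homs(1)[OF inj mP] *(5)])
  have "(\<lambda>x. f (\<psi> x)) ` carrier P \<subseteq> g ` carrier N"
    using module_homs_closed[OF f\<psi>] *(4) by blast
  from projective_module_lift[OF P *(1,2,3) f\<psi> this] obtain h
    where h: "h \<in> module_homs ring_of_type_algebra P N" "\<forall>x\<in>carrier P. g (h x) = f (\<psi> x)" by blast
  show "\<exists>h\<in>module_homs ring_of_type_algebra (transported_module \<psi> P) N.
      \<forall>x\<in>carrier (transported_module \<psi> P). g (h x) = f x"
    by (rule bexI[OF _ module_homs_comp[OF transported_module_homs(2)[OF inj mP] h(1)]])
      (use h(2) in \<open>auto simp: inv_into_f_f[OF inj]\<close>)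
qed

lemma projective_dimension_le:
  fixes M :: "('a :: comm_ring_1, 'm) module" and P :: "nat \<Rightarrow> ('a, 'p) module"
    and \<psi> :: "'p \<Rightarrow> nat \<times> 'a \<times> 'm \<Rightarrow> 'a"
  assumes M: "module ring_of_type_algebra M"
    and P: "projective_resolution ring_of_type_algebra M P d e"
    and inj: "\<And>i. inj_on \<psi> (carrier (P i))"
    and len: "\<And>i. i > k \<Longrightarrow> carrier (P i) = {\<zero>\<^bsub>P i\<^esub>}"
  shows "projective_dimension ring_of_type_algebra M \<le> enat k"
proof -
  note PD = projective_resolutionD[OF P]
  let ?R = "ring_of_type_algebra :: 'a ring"
  define Q where "Q i = transported_module \<psi> (P i)" for i
  define \<theta> where "\<theta> i = inv_into (carrier (P i)) \<psi>" for i
  have inv: "\<theta> i (\<psi> x) = x" if "x \<in> carrier (P i)" for i x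
    unfolding \<theta>_def by (rule inv_into_f_f[OF inj that])
  have cQ: "carrier (Q i) = \<psi> ` carrier (P i)" "\<zero>\<^bsub>Q i\<^esub> = \<psi> \<zero>\<^bsub>P i\<^esub>" for i
    by (simp_all add: Q_def)
  have \<psi>: "\<psi> \<in> module_homs ?R (P i) (Q i)" for i
    unfolding Q_def by (rule transported_module_homs(1)[OF inj PD(2)])
  have \<theta>: "\<theta> i \<in> module_homs ?R (Q i) (P i)" for i
    unfolding Q_def \<theta>_def by (rule transported_module_homs(2)[OF inj PD(2)])
  have zero: "\<zero>\<^bsub>P i\<^esub> \<in> carrier (P i)" for i
    by (rule abelian_monoid.zero_closed[OF abelian_group.axioms(1)[OF module.axioms(2)[OF PD(2)]]])
  have \<psi>_zero: "\<psi> x = \<zero>\<^bsub>Q i\<^esub> \<longleftrightarrow> x = \<zero>\<^bsub>P i\<^esub>" if "x \<in> carrier (P i)" for x i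
    using inj_onD[OF inj _ that zero] by (auto simp: cQ)
  have dP: "d i x \<in> carrier (P i)" if "x \<in> carrier (P (Suc i))" for i x
    by (rule module_homs_closed[OF PD(4) that])
  let ?d = "\<lambda>i x. \<psi> (d i (\<theta> (Suc i) x))" and ?e = "\<lambda>x. e (\<theta> 0 x)"
  have "projective_resolution ?R M Q ?d ?e"
    unfolding projective_resolution_def
  proof (intro conjI allI)
    show "projective_module ?R (Q i)" for i
      unfolding Q_def by (rule projective_transported[OF PD(1) inj])
    show "?e \<in> module_homs ?R (Q 0) M" by (rule module_homs_comp[OF \<theta> PD(3)])
    show "?d i \<in> module_homs ?R (Q (Suc i)) (Q i)" for i
      by (rule module_homs_comp[OF module_homs_comp[OF \<theta> PD(4)] \<psi>])
    show "?e ` carrier (Q 0) = carrier M"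
      unfolding cQ image_image PD(5)[symmetric] by (rule image_cong[OF refl]) (simp add: inv)
    have im: "?d i ` carrier (Q (Suc i)) = \<psi> ` d i ` carrier (P (Suc i))" for i
      unfolding cQ image_image by (rule image_cong[OF refl]) (simp add: inv)
    show "?d 0 ` carrier (Q (Suc 0)) = {x \<in> carrier (Q 0). ?e x = \<zero>\<^bsub>M\<^esub>}"
      unfolding im unfolding cQ using PD(6) dP by (auto simp: inv)
    show "?d (Suc i) ` carrier (Q (Suc (Suc i))) = {x \<in> carrier (Q (Suc i)). ?d i x = \<zero>\<^bsub>Q i\<^esub>}" for i
    proof -
      have "?d i (\<psi> x) = \<zero>\<^bsub>Q i\<^esub> \<longleftrightarrow> x \<in> d (Suc i) ` carrier (P (Suc (Suc i)))"
        if "x \<in> carrier (P (Suc i))" for x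
        using that PD(7)[OF that] \<psi>_zero[OF dP[OF that]] by (simp add: inv)
      then show ?thesis
        unfolding im cQ(1)[of "Suc i"] using PD(8)[of "Suc i"] by auto
    qed
  qed
  moreover have "\<forall>i>k. carrier (Q i) = {\<zero>\<^bsub>Q i\<^esub>}"
    using len by (simp add: cQ)
  ultimately show ?thesis
    unfolding projective_dimension_def by (intro Inf_lower) blast
qed

text \<open>A resolution of length at most \<open>i\<close> vanishes in degree \<open>Suc i\<close>
  and would provide, by the homotopy argument, exactly the maps that the last hypothesis
  excludes.\<close>

lemma projective_dimension_ge:
  fixes M :: "('a :: comm_ring_1, 'm) module" and T :: "nat \<Rightarrow> ('a, 't) module"
  assumes M: "module ring_of_type_algebra M"
    and T: "projective_resolution ring_of_type_algebra M T d' e'"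
    and no_homotopy: "\<And>s s'. s \<in> module_homs ring_of_type_algebra (T i) (T (Suc i)) \<Longrightarrow>
      s' \<in> module_homs ring_of_type_algebra (T (Suc i)) (T (Suc (Suc i))) \<Longrightarrow>
      \<exists>x \<in> carrier (T (Suc i)). x \<noteq> d' (Suc i) (s' x) \<oplus>\<^bsub>T (Suc i)\<^esub> s (d' i x)"
  shows "enat (Suc i) \<le> projective_dimension ring_of_type_algebra M"
  unfolding projective_dimension_def
proof (rule Inf_greatest)
  fix x assume "x \<in> {enat k |k. \<exists>P d e. projective_resolution ring_of_type_algebra M
    (P :: nat \<Rightarrow> ('a, nat \<times> 'a \<times> 'm \<Rightarrow> 'a) module) d e \<and> (\<forall>i>k. carrier (P i) = {\<zero>\<^bsub>P i\<^esub>})}"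
  then obtain k d e and P :: "nat \<Rightarrow> ('a, nat \<times> 'a \<times> 'm \<Rightarrow> 'a) module"
    where k: "x = enat k" "projective_resolution ring_of_type_algebra M P d e"
      "\<forall>i>k. carrier (P i) = {\<zero>\<^bsub>P i\<^esub>}" by blast
  have "\<not> k < Suc i"
    using contracting_homotopy_beyond_length[OF M k(2) T, of i] k(3) no_homotopy by blast
  then show "enat (Suc i) \<le> x" using k(1) by simp
qed

text \<open>The conditions on \<open>J\<close> say that the chains of degree \<open>k\<close> are
  the direct sum of the chains on \<open>J\<close> and the boundaries. Hence the differential is
  injective on the chains on \<open>J\<close> and keeps its image, and the complex can be cut off
  there.\<close>

lemma taylor_resolution:
  fixes A :: "nat \<Rightarrow> 'n :: finite set" and I :: "('n, 'k :: comm_ring_1) mpoly set"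
  assumes V: "finite V" and ideal: "ideal I polynomial_ring"
    and I: "I = {p. \<forall>c \<in> Poly_Mapping.keys p. \<exists>j\<in>V. A j \<subseteq> Poly_Mapping.keys c}"
    and k: "0 < k" and J: "J \<subseteq> faces V k"
    and J_inj: "\<And>y :: nat set \<Rightarrow> ('n, 'k) mpoly. y \<in> carrier (taylor_module A J) \<Longrightarrow>
      boundary V y = (\<lambda>_. 0) \<Longrightarrow> y = (\<lambda>_. 0)"
    and J_surj: "\<And>y :: nat set \<Rightarrow> ('n, 'k) mpoly. y \<in> carrier (taylor_module A (faces V k)) \<Longrightarrow>
      \<exists>z \<in> carrier (taylor_module A (faces V (Suc k))).
        (\<lambda>\<sigma>. y \<sigma> - boundary V z \<sigma>) \<in> carrier (taylor_module A J)"
  shows "projective_resolution polynomial_ring (quotient_module polynomial_ring I)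
    (\<lambda>i. taylor_module A (if i < k then faces V i else if i = k then J else {}))
    (\<lambda>_. boundary V) (\<lambda>y. I +>\<^bsub>polynomial_ring\<^esub> y {})"
proof -
  let ?R = "polynomial_ring :: ('n, 'k) mpoly ring"
  let ?T = "\<lambda>i. taylor_module A (faces V i) :: (('n, 'k) mpoly, nat set \<Rightarrow> ('n, 'k) mpoly) module"
  let ?F = "\<lambda>i. if i < k then faces V i else if i = k then J else {}"
  let ?P = "\<lambda>i. taylor_module A (?F i) :: (('n, 'k) mpoly, nat set \<Rightarrow> ('n, 'k) mpoly) module"
  interpret I: ideal I ?R by fact
  have F: "?F i \<subseteq> faces V i" for i using J by auto
  have trivial: "carrier (taylor_module A {} ::
      (('n, 'k) mpoly, nat set \<Rightarrow> ('n, 'k) mpoly) module) = {\<lambda>_. 0}"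
    by (auto simp: taylor_module_def)
  have boundary_0: "boundary V (\<lambda>_. 0 :: ('n, 'k) mpoly) = (\<lambda>_. 0)"
    by (rule ext) (simp add: boundary_def)
  have bdry_mem: "boundary V y \<in> carrier (?P i)" if y: "y \<in> carrier (?P (Suc i))" for i y
  proof (cases "i < k")
    case True
    then show ?thesis
      using boundary_taylor_carrier[OF V subsetD[OF taylor_module_mono[OF F] y]] by simp
  next
    case False
    then have "y = (\<lambda>_. 0)" using y trivial by simp
    then show ?thesis using boundary_0 by (simp add: taylor_module_def)
  qed
  \<comment> \<open>Passing to \<open>J\<close> in degree \<open>k\<close> only removes boundaries,
    which the differential kills.\<close>
  have im: "boundary V ` carrier (?P (Suc i)) = boundary V ` carrier (?T (Suc i))" if "i < k" for i
  proof (cases "Suc i < k")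
    case True
    then show ?thesis by simp
  next
    case False
    with that have i: "Suc i = k" by simp
    have "boundary V y \<in> boundary V ` carrier (taylor_module A J)"
      if y: "y \<in> carrier (?T k)" for y
    proof -
      obtain z where z: "(\<lambda>\<sigma>. y \<sigma> - boundary V z \<sigma>) \<in> carrier (taylor_module A J)"
        using J_surj[OF y] by blast
      have "boundary V y = boundary V (\<lambda>\<sigma>. y \<sigma> - boundary V z \<sigma>)"
        unfolding boundary_diff boundary_boundary[OF V] by simp
      then show ?thesis using z by blast
    qed
    moreover have "carrier (taylor_module A J) \<subseteq> carrier (?T k)" by (rule taylor_module_mono[OF J])
    ultimately show ?thesis unfolding i by auto
  qed
  have e_eq: "I +>\<^bsub>?R\<^esub> x = \<zero>\<^bsub>quotient_module ?R I\<^esub> \<longleftrightarrow> x \<in> I" for x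
    using a_r_coset_eq_iff_mem[OF ideal, of x] by (simp add: quotient_module_def FactRing_def)
  have sub: "boundary V y {} \<in> I" if "y \<in> carrier (?T (Suc 0))" for y
  proof -
    note y' = that[unfolded taylor_module_carrier_iff[OF finite_faces[OF V]]]
    have "y {i} \<in> I" if "i \<in> V" for i
    proof -
      have "squarefree_monomial (A i) dvd y {i}" using y'[rule_format, of "{i}"] by simp
      then show ?thesis unfolding I squarefree_monomial_dvd_iff using that by blast
    qed
    then show ?thesis
      unfolding boundary_def by (auto intro!: ideal_type_ring_sum[OF ideal] ideal_type_ringD(3)[OF
          ideal])
  qed
  show ?thesis
    unfolding projective_resolution_def
  proof (intro conjI allI)
    show "projective_module ?R (?P i)" for i by (rule projective_taylor_module)
    show "(\<lambda>y. I +>\<^bsub>?R\<^esub> y {}) \<in> module_homs ?R (?P 0) (quotient_module ?R I)"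
    proof (rule module_homsI)
      fix x y :: "nat set \<Rightarrow> ('n, 'k) mpoly" and r :: "('n, 'k) mpoly"
      show "I +>\<^bsub>?R\<^esub> x {} \<in> carrier (quotient_module ?R I)"
        using I.a_rcosetsI[OF I.a_subset, of "x {}"] by (simp add: quotient_module_def FactRing_def)
      show "I +>\<^bsub>?R\<^esub> (x \<oplus>\<^bsub>?P 0\<^esub> y) {} =
          (I +>\<^bsub>?R\<^esub> x {}) \<oplus>\<^bsub>quotient_module ?R I\<^esub> (I +>\<^bsub>?R\<^esub> y {})"
        using I.a_rcos_sum[of "x {}" "y {}"] by (simp add: quotient_module_def FactRing_def)
      show "I +>\<^bsub>?R\<^esub> (r \<odot>\<^bsub>?P 0\<^esub> x) {} = r \<odot>\<^bsub>quotient_module ?R I\<^esub> (I +>\<^bsub>?R\<^esub> x {})"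
        using I.rcoset_mult_add[of r "x {}"] by (simp add: quotient_module_def FactRing_def)
    qed
    show "boundary V \<in> module_homs ?R (?P (Suc i)) (?P i)" for i
      by (rule module_homsI) (use bdry_mem in \<open>auto simp: boundary_add boundary_smult\<close>)
    show "(\<lambda>y. I +>\<^bsub>?R\<^esub> y {}) ` carrier (?P 0) = carrier (quotient_module ?R I)"
    proof -
      have "C \<in> (\<lambda>y. I +>\<^bsub>?R\<^esub> y {}) ` carrier (?P 0)" if C: "C \<in> carrier (quotient_module ?R I)"
          for C
      proof -
        obtain x where x: "C = I +>\<^bsub>?R\<^esub> x"
          using C by (auto simp: quotient_module_def FactRing_def A_RCOSETS_defs a_r_coset_def)
        have "(\<lambda>\<sigma>. if \<sigma> = {} then x else 0) \<in> carrier (?P 0)"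
        proof -
          have "{} \<in> faces V 0" by (simp add: faces_def)
          then have "(\<lambda>\<sigma>. if \<sigma> = {} then x else 0) \<in> carrier (?T 0)"
            unfolding taylor_module_carrier_iff[OF finite_faces[OF V]]
            by (auto simp: squarefree_monomial_dvd_iff)
          then show ?thesis using k by simp
        qed
        then show ?thesis unfolding x by (rule image_eqI[rotated]) simp
      qed
      moreover have "I +>\<^bsub>?R\<^esub> x {} \<in> carrier (quotient_module ?R I)"
          for x :: "nat set \<Rightarrow> ('n, 'k) mpoly"
        using I.a_rcosetsI[OF I.a_subset, of "x {}"] by (simp add: quotient_module_def FactRing_def)
      ultimately show ?thesis by blast
    qed
    show "boundary V ` carrier (?P (Suc 0)) =
        {x \<in> carrier (?P 0). I +>\<^bsub>?R\<^esub> x {} = \<zero>\<^bsub>quotient_module ?R I\<^esub>}"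
    proof -
      have "y \<in> boundary V ` carrier (?T (Suc 0))" if y: "y \<in> carrier (?T 0)" and yI: "y {} \<in> I"
          for y
      proof -
        note y' = y[unfolded taylor_module_carrier_iff[OF finite_faces[OF V]]]
        have y0: "y \<sigma> = 0" if "\<sigma> \<noteq> {}" for \<sigma>
        proof -
          have "\<sigma> \<notin> faces V 0" using that V by (auto simp: faces_def dest: finite_subset)
          then show ?thesis using y' by blast
        qed
        have "boundary V y = (\<lambda>_. 0)"
          by (rule ext) (simp add: boundary_def y0)
        moreover have "\<exists>j\<in>V. A j \<subseteq> Poly_Mapping.keys c" if "c \<in> Poly_Mapping.keys (y \<sigma>)" for \<sigma> c
          using that yI y0[of \<sigma>] unfolding I by (cases "\<sigma> = {}") auto
        ultimately show ?thesis using taylor_complex_exact[OF V y] by blast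
      qed
      then show ?thesis
        unfolding im[OF k] e_eq using k sub boundary_taylor_carrier[OF V, of _ A 0] by auto
    qed
    show "boundary V ` carrier (?P (Suc (Suc i))) =
        {x \<in> carrier (?P (Suc i)). boundary V x = \<zero>\<^bsub>?P i\<^esub>}" for i
    proof (cases "Suc i < k")
      case True
      have "y \<in> boundary V ` carrier (?T (Suc (Suc i)))"
        if y: "y \<in> carrier (?T (Suc i))" and cyc: "boundary V y = (\<lambda>_. 0)" for y
        using taylor_complex_exact_Suc[OF V y cyc] by blast
      then show ?thesis
        unfolding im[OF True] using True boundary_taylor_carrier[OF V, of _ A "Suc i"]
            boundary_boundary[OF V]
        by auto
    next
      case False
      have "y = (\<lambda>_. 0)" if y: "y \<in> carrier (?P (Suc i))" and "boundary V y = (\<lambda>_. 0)" for y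
        using that False J_inj trivial by (cases "Suc i = k") auto
      moreover have "(\<lambda>_. 0) \<in> carrier (?P (Suc i))" by (simp add: taylor_module_def)
      ultimately show ?thesis using False trivial boundary_0 by auto
    qed
  qed
qed


section \<open>Lower bounds\<close>

lemma lookup_squarefree_monomial_mult:
  "Poly_Mapping.lookup (squarefree_monomial A * p) (squarefree_exponent A) =
    Poly_Mapping.lookup (p :: ('n :: finite, 'k :: comm_ring_1) mpoly) 0"
  using lookup_monomial_mult[of "squarefree_exponent A" p 0] by (simp add: squarefree_monomial_def)

lemma lookup_squarefree_monomial [simp]:
  "Poly_Mapping.lookup (squarefree_monomial A :: ('n :: finite, 'k ::
      comm_ring_1) mpoly) (squarefree_exponent A) = 1"
  by (simp add: squarefree_monomial_def)

text \<open>Homomorphisms preserve multiples by the irrelevant maximal ideal, and such multiples are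
  recognised by the coefficients at the degrees of the basis elements.\<close>

lemma taylor_homs_coefficient_eq_0:
  fixes A :: "nat \<Rightarrow> 'n :: finite set" and z :: "nat set \<Rightarrow> ('n, 'k :: comm_ring_1) mpoly"
  assumes s: "s \<in> module_homs polynomial_ring (taylor_module A J) (taylor_module A J')"
    and J: "finite J" and J': "finite J'"
    and z: "z \<in> carrier (taylor_module A J)"
    and strict: "\<And>\<tau>. z \<tau> \<noteq> 0 \<Longrightarrow> \<exists>v. v \<notin> \<Union>(A ` \<tau>) \<and> squarefree_monomial (insert v (\<Union>(A ` \<tau>))) dvd z \<tau>"
  shows "Poly_Mapping.lookup (s z \<sigma>) (squarefree_exponent (\<Union>(A ` \<sigma>))) = 0"
proof -
  let ?U = "\<lambda>\<tau>. \<Union>(A ` \<tau>)"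
  let ?T = "taylor_module A J :: (('n, 'k) mpoly, nat set \<Rightarrow> ('n, 'k) mpoly) module"
  note T_iff = taylor_module_carrier_iff[OF J]
  have *: "Poly_Mapping.lookup (s z \<sigma>) (squarefree_exponent (?U \<sigma>)) = 0"
    if "finite C" "z \<in> carrier ?T" "{\<tau>. z \<tau> \<noteq> 0} \<subseteq> C"
      "\<forall>\<tau>. z \<tau> \<noteq> 0 \<longrightarrow> (\<exists>v. v \<notin> ?U \<tau> \<and> squarefree_monomial (insert v (?U \<tau>)) dvd z \<tau>)" for C z
    using that
  proof (induction C arbitrary: z rule: finite_induct)
    case empty
    then have "z = \<zero>\<^bsub>?T\<^esub>" by (auto simp: fun_eq_iff)
    moreover have "s \<zero>\<^bsub>?T\<^esub> = (\<lambda>_. 0)"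
      using module_homs_zero[OF _ _ s] by (simp add: taylor_module_def module_weighted_free)
    ultimately show ?case by simp
  next
    case (insert \<tau> C)
    show ?case
    proof (cases "z \<tau> = 0")
      case True
      with insert.prems(2) have "{\<tau>. z \<tau> \<noteq> 0} \<subseteq> C" by auto
      then show ?thesis by (rule insert.IH[OF insert.prems(1) _ insert.prems(3)])
    next
      case False
      then obtain v where v: "v \<notin> ?U \<tau>" "squarefree_monomial (insert v (?U \<tau>)) dvd z \<tau>"
        using insert.prems(3) by blast
      \<comment> \<open>The variable \<open>v\<close> is split off in front of a multiple of the
        basis element, so that linearity carries it through \<open>s\<close>.\<close>
      then obtain q where q: "z \<tau> = indeterminate v * (squarefree_monomial (?U \<tau>) * q)"
        unfolding squarefree_monomial_insert[OF v(1)] by (auto simp: dvd_def mult.assoc)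
      define z' where "z' = z(\<tau> := 0)"
      define y where "y = (\<lambda>u. if u = \<tau> then squarefree_monomial (?U \<tau>) * q else 0)"
      have \<tau>: "\<tau> \<in> J" using False insert.prems(1) by (auto simp: T_iff)
      have z': "z' \<in> carrier ?T" using insert.prems(1) by (auto simp: T_iff z'_def)
      have y: "y \<in> carrier ?T" using \<tau> by (auto simp: T_iff y_def)
      have iy: "indeterminate v \<odot>\<^bsub>?T\<^esub> y \<in> carrier ?T" using y by (auto simp: T_iff intro: dvd_mult)
      have "z = z' \<oplus>\<^bsub>?T\<^esub> indeterminate v \<odot>\<^bsub>?T\<^esub> y"
        by (auto simp: fun_eq_iff z'_def y_def q)
      then have "s z = s z' \<oplus>\<^bsub>taylor_module A J'\<^esub> indeterminate v \<odot>\<^bsub>taylor_module A J'\<^esub> s y"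
        using module_homs_add[OF s z' iy] module_homs_smult[OF s _ y, of "indeterminate v"] by simp
      then have "s z \<sigma> = s z' \<sigma> + indeterminate v * s y \<sigma>" by simp
      moreover have "Poly_Mapping.lookup (s z' \<sigma>) (squarefree_exponent (?U \<sigma>)) = 0"
        by (rule insert.IH[OF z']) (use insert.prems in \<open>auto simp: z'_def\<close>)
      moreover have "squarefree_monomial (?U \<sigma>) dvd s y \<sigma>"
        using module_homs_closed[OF s y] unfolding taylor_module_carrier_iff[OF J'] by blast
      ultimately show ?thesis by (simp add: lookup_add lookup_indeterminate_mult_eq_0)
    qed
  qed
  have "{\<tau>. z \<tau> \<noteq> 0} \<subseteq> J" using z by (auto simp: T_iff)
  with strict show ?thesis by (intro *[OF J z]) auto
qed

text \<open>The case \<open>J = {}\<close> of the truncation, one degree above the top face, where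
  no faces are left.\<close>

lemma taylor_full_resolution:
  fixes A :: "nat \<Rightarrow> 'n :: finite set" and I :: "('n, 'k :: comm_ring_1) mpoly set"
  assumes V: "finite V" and ideal: "ideal I polynomial_ring"
    and I: "I = {p. \<forall>c \<in> Poly_Mapping.keys p. \<exists>j\<in>V. A j \<subseteq> Poly_Mapping.keys c}"
  shows "projective_resolution polynomial_ring (quotient_module polynomial_ring I)
    (\<lambda>i. taylor_module A (faces V i)) (\<lambda>_. boundary V) (\<lambda>y. I +>\<^bsub>polynomial_ring\<^esub> y {})"
proof -
  have large: "faces V i = {}" if "card V < i" for i
  proof -
    have "card \<sigma> \<noteq> i" if "\<sigma> \<subseteq> V" for \<sigma>
      using card_mono[OF V that] \<open>card V < i\<close> by simp
    then show ?thesis by (auto simp: faces_def)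
  qed
  have eq: "(\<lambda>i. taylor_module A (if i < Suc (card V) then faces V i else if i =
      Suc (card V) then {} else {})) =
      (\<lambda>i. taylor_module A (faces V i) :: (('n, 'k) mpoly, nat set \<Rightarrow> ('n, 'k) mpoly) module)"
    using large by (auto simp: fun_eq_iff)
  have trivial: "y \<in> carrier (taylor_module A {}) \<longleftrightarrow> y = (\<lambda>_. 0)" for y :: "nat set \<Rightarrow> ('n, 'k) mpoly"
    by (auto simp: taylor_module_def)
  have boundary_0: "boundary V (\<lambda>_. 0 :: ('n, 'k) mpoly) = (\<lambda>_. 0)"
    by (rule ext) (simp add: boundary_def)
  have "faces V (Suc (card V)) = {}" "faces V (Suc (Suc (card V))) = {}"
    by (simp_all add: large)
  then show ?thesis
    by (intro taylor_resolution[OF V ideal I, of "Suc (card V)" "{}", unfolded eq])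
      (simp_all add: trivial boundary_0)
qed

text \<open>\<open>strict\<close> makes the boundary of \<open>x\<close> zero modulo the maximal
  ideal, and \<open>nonzero\<close> prevents \<open>x\<close> from being a boundary modulo it. In a
  homotopy equation the term \<open>s (boundary V x)\<close> has coefficient zero in the tested
  degree and cannot make up the difference.\<close>

lemma taylor_lower_bound:
  fixes A :: "nat \<Rightarrow> 'n :: finite set" and I :: "('n, 'k :: comm_ring_1) mpoly set"
  assumes V: "finite V" and ideal: "ideal I polynomial_ring"
    and I: "I = {p. \<forall>c \<in> Poly_Mapping.keys p. \<exists>j\<in>V. A j \<subseteq> Poly_Mapping.keys c}"
    and x: "x \<in> carrier (taylor_module A (faces V (Suc i)) :: (('n, 'k) mpoly, _) module)"
    and strict: "\<And>\<tau>. boundary V x \<tau> \<noteq> 0 \<Longrightarrow>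
      \<exists>v. v \<notin> \<Union>(A ` \<tau>) \<and> squarefree_monomial (insert v (\<Union>(A ` \<tau>))) dvd boundary V x \<tau>"
    and nonzero: "\<And>z. z \<in> carrier (taylor_module A (faces V (Suc (Suc i)))) \<Longrightarrow>
      \<exists>\<sigma>. Poly_Mapping.lookup (x \<sigma> - boundary V z \<sigma>) (squarefree_exponent (\<Union>(A ` \<sigma>))) \<noteq> 0"
  shows "enat (Suc i) \<le> projective_dimension polynomial_ring (quotient_module polynomial_ring I)"
proof (rule projective_dimension_ge[OF module_quotient_module[OF ideal cring_from_type_algebra]
      taylor_full_resolution[OF V ideal I]], rule bexI[OF _ x], rule notI)
  fix s s' :: "(nat set \<Rightarrow> ('n, 'k) mpoly) \<Rightarrow> nat set \<Rightarrow> ('n, 'k) mpoly"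
  assume s: "s \<in> module_homs polynomial_ring (taylor_module A (faces V i)) (taylor_module A (faces
      V (Suc i)))"
    and s': "s' \<in> module_homs polynomial_ring (taylor_module A (faces V (Suc i))) (taylor_module A
        (faces V (Suc (Suc i))))"
    and eq: "x = boundary V (s' x) \<oplus>\<^bsub>taylor_module A (faces V (Suc i))\<^esub> s (boundary V x)"
  obtain \<sigma> where \<sigma>: "Poly_Mapping.lookup (x \<sigma> - boundary V (s' x) \<sigma>) (squarefree_exponent (\<Union>(A `
      \<sigma>))) \<noteq> 0"
    using nonzero[OF module_homs_closed[OF s' x]] by blast
  have "x \<sigma> = boundary V (s' x) \<sigma> + s (boundary V x) \<sigma>"
    by (subst eq) simp
  then have "x \<sigma> - boundary V (s' x) \<sigma> = s (boundary V x) \<sigma>" by simp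
  then show False
    using \<sigma> taylor_homs_coefficient_eq_0[OF s finite_faces[OF V] finite_faces[OF V]
      boundary_taylor_carrier[OF V x] strict, of \<sigma>] by simp
qed

section \<open>Faces that omit one or two vertices\<close>

lemma boundary_Diff_singleton:
  assumes "i \<in> V"
  shows "boundary V y (V - {i}) = incidence_sign i (V - {i}) * y V"
proof -
  have "V - (V - {i}) = {i}" "insert i V = V" using assms by auto
  then show ?thesis by (simp add: boundary_def)
qed

lemma boundary_Diff_pair:
  assumes "a \<in> V" "b \<in> V" "a \<noteq> b"
  shows "boundary V y (V - {a, b}) =
    incidence_sign a (V - {a, b}) * y (V - {b}) + incidence_sign b (V - {a, b}) * y (V - {a})"
proof -
  have "V - (V - {a, b}) = {a, b}" "insert a (V - {a, b}) = V - {b}" "insert b (V - {a, b}) =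
      V - {a}"
    using assms by auto
  then show ?thesis using assms(3) by (simp add: boundary_def)
qed

lemma faces_card: "finite V \<Longrightarrow> faces V (card V) = {V}"
  unfolding faces_def using card_subset_eq[of V] by blast

lemma faces_card_minus_1:
  assumes "finite V" "card V = Suc k" "\<tau> \<in> faces V k"
  shows "\<exists>i\<in>V. \<tau> = V - {i}"
proof -
  have \<tau>: "\<tau> \<subseteq> V" "card \<tau> = k" using assms(3) by (auto simp: faces_def)
  then have "card (V - \<tau>) = 1"
    using assms(1,2) card_Diff_subset[OF finite_subset[OF \<tau>(1) assms(1)] \<tau>(1)] by simp
  then obtain i where "V - \<tau> = {i}" by (auto simp: card_1_singleton_iff)
  then have "i \<in> V" "\<tau> = V - {i}" using \<tau>(1) by auto
  then show ?thesis by blast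
qed

lemma faces_card_minus_2:
  assumes "finite V" "card V = Suc (Suc k)" "\<tau> \<in> faces V k"
  shows "\<exists>a\<in>V. \<exists>b\<in>V. a \<noteq> b \<and> \<tau> = V - {a, b}"
proof -
  have \<tau>: "\<tau> \<subseteq> V" "card \<tau> = k" using assms(3) by (auto simp: faces_def)
  then have "card (V - \<tau>) = 2"
    using assms(1,2) card_Diff_subset[OF finite_subset[OF \<tau>(1) assms(1)] \<tau>(1)] by simp
  then obtain a b where ab: "V - \<tau> = {a, b}" "a \<noteq> b" by (auto simp: card_2_iff)
  then have "a \<in> V" "b \<in> V" "\<tau> = V - {a, b}" using \<tau>(1) by auto
  with ab(2) show ?thesis by blast
qed

lemma Diff_singleton_in_faces:
  "finite V \<Longrightarrow> card V = Suc k \<Longrightarrow> i \<in> V \<Longrightarrow> V - {i} \<in> faces V k"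
  by (simp add: faces_def)

lemma squarefree_monomial_strict_dvd:
  assumes "S \<subseteq> S'" "S \<noteq> S'" "squarefree_monomial S' dvd p"
  shows "\<exists>v. v \<notin> S \<and> squarefree_monomial (insert v S) dvd p"
proof -
  obtain v where "v \<in> S'" "v \<notin> S" using assms by blast
  then have "insert v S \<subseteq> S'" using assms(1) by blast
  then have "squarefree_monomial (insert v S) dvd p"
    by (rule dvd_trans[OF squarefree_monomial_dvd_mono assms(3)])
  with \<open>v \<notin> S\<close> show ?thesis by blast
qed

section \<open>The Taylor complex of a fixed ideal and its cycles modulo the maximal ideal\<close>

locale taylor_ideal =
  fixes V :: "nat set" and A :: "nat \<Rightarrow> 'n :: finite set"
      and I :: "('n, 'k :: comm_ring_1) mpoly set"
  assumes finite_V: "finite V" and ideal_I: "ideal I polynomial_ring"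
    and I_eq: "I = {p. \<forall>c \<in> Poly_Mapping.keys p. \<exists>j\<in>V. A j \<subseteq> Poly_Mapping.keys c}"
begin

definition U :: "nat set \<Rightarrow> 'n set" where
  "U \<sigma> = \<Union>(A ` \<sigma>)"

text \<open>These turn out to be the vertices in \<open>W\<close>: no variable divides the generator
  of \<open>i\<close> alone.\<close>

definition redundant :: "nat set" where
  "redundant = {i \<in> V. U (V - {i}) = U V}"

abbreviation mon :: "'n set \<Rightarrow> ('n, 'k) mpoly" where
  "mon \<equiv> squarefree_monomial"

abbreviation T :: "nat \<Rightarrow> (('n, 'k) mpoly, nat set \<Rightarrow> ('n, 'k) mpoly) module" where
  "T i \<equiv> taylor_module A (faces V i)"

abbreviation pd :: enat where
  "pd \<equiv> projective_dimension polynomial_ring (quotient_module polynomial_ring I)"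

lemma U_mono: "\<sigma> \<subseteq> \<tau> \<Longrightarrow> U \<sigma> \<subseteq> U \<tau>"
  by (auto simp: U_def)

lemma T_iff: "y \<in> carrier (T k) \<longleftrightarrow> (\<forall>\<sigma>. (\<sigma> \<notin> faces V k \<longrightarrow> y \<sigma> = 0) \<and> mon (U \<sigma>) dvd y \<sigma>)"
  by (simp add: taylor_module_carrier_iff[OF finite_faces[OF finite_V]] U_def)

lemmas lower_bound = taylor_lower_bound[OF finite_V ideal_I I_eq, folded U_def]

lemma strict_dvdI:
  assumes "\<tau> \<subseteq> \<sigma>" "U \<tau> \<noteq> U \<sigma>" "mon (U \<sigma>) dvd p"
  shows "\<exists>v. v \<notin> U \<tau> \<and> mon (insert v (U \<tau>)) dvd p"
  using squarefree_monomial_strict_dvd[OF U_mono[OF assms(1)] assms(2,3)] .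

text \<open>A vertex \<open>j\<close> that is not redundant owns a variable occurring in no other
  generator, and this variable is lost whenever \<open>j\<close> is removed.\<close>

lemma U_Diff_pair_neq:
  assumes "j \<in> V" "j \<notin> redundant" "i \<noteq> j"
  shows "U (V - {i, j}) \<noteq> U (V - {i})"
proof -
  have "U (V - {j}) \<noteq> U V" using assms by (simp add: redundant_def)
  then obtain v where v: "v \<in> U V" "v \<notin> U (V - {j})" using U_mono[of "V - {j}" V] by blast
  then have "v \<in> A j" by (auto simp: U_def)
  then have "v \<in> U (V - {i})" using assms(1,3) by (auto simp: U_def)
  moreover have "v \<notin> U (V - {i, j})" using v(2) U_mono[of "V - {i, j}" "V - {j}"] by blast
  ultimately show ?thesis by blast
qed

text \<open>All facets have smaller degree than \<open>V\<close>, so the boundary of the top face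
  vanishes modulo the maximal ideal, and there are no larger faces that could make it a
  boundary.\<close>

lemma lower_bound_no_redundant:
  assumes "redundant = {}" "card V = Suc k"
  shows "enat (card V) \<le> pd"
proof -
  define x where "x = (\<lambda>\<sigma>. if \<sigma> = V then mon (U V) else 0)"
  have "enat (Suc k) \<le> pd"
  proof (rule lower_bound)
    show x: "x \<in> carrier (T (Suc k))"
      unfolding T_iff using faces_card[OF finite_V] by (simp add: x_def assms(2))
    fix \<tau> assume nz: "boundary V x \<tau> \<noteq> 0"
    then have "\<tau> \<in> faces V k"
      using boundary_taylor_carrier[OF finite_V x] unfolding T_iff by blast
    then obtain i where i: "i \<in> V" "\<tau> = V - {i}"
      using faces_card_minus_1[OF finite_V assms(2)] by blast
    show "\<exists>v. v \<notin> U \<tau> \<and> mon (insert v (U \<tau>)) dvd boundary V x \<tau>"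
    proof (rule strict_dvdI[of _ V])
      show "U \<tau> \<noteq> U V" using assms(1) i by (auto simp: redundant_def)
    qed (auto simp: i boundary_Diff_singleton x_def)
  next
    fix z assume "z \<in> carrier (T (Suc (Suc k)))"
    moreover have "V \<notin> faces V (Suc (Suc k))" by (simp add: faces_def assms(2))
    ultimately have "boundary V z V = 0" by (simp add: boundary_def)
    then have "Poly_Mapping.lookup (x V - boundary V z V) (squarefree_exponent (U V)) = 1"
      by (simp add: x_def)
    then show "\<exists>\<sigma>. Poly_Mapping.lookup (x \<sigma> - boundary V z \<sigma>) (squarefree_exponent (U \<sigma>)) \<noteq> 0"
      by (intro exI[of _ V]) simp
  qed
  then show ?thesis using assms(2) by simp
qed

text \<open>Removing a further vertex \<open>j\<close> from \<open>V - {i}\<close> always loses a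
  variable: by \<open>edge\<close> if \<open>j\<close> is redundant, by its own variable otherwise.
  The only coface \<open>V\<close> has larger degree because \<open>i\<close> is not redundant, so
  \<open>V - {i}\<close> is not a boundary modulo the maximal ideal.\<close>

lemma lower_bound_private:
  assumes card: "card V = Suc (Suc k)" and i: "i \<in> V" "i \<notin> redundant"
    and edge: "\<And>j. j \<in> redundant \<Longrightarrow> U (V - {i, j}) \<noteq> U (V - {i})"
  shows "enat (Suc k) \<le> pd"
proof (rule lower_bound)
  let ?\<rho> = "V - {i}"
  define x where "x = (\<lambda>\<sigma>. if \<sigma> = ?\<rho> then mon (U ?\<rho>) else 0)"
  have \<rho>: "?\<rho> \<in> faces V (Suc k)" by (rule Diff_singleton_in_faces[OF finite_V card i(1)])
  then show x: "x \<in> carrier (T (Suc k))"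
    by (auto simp: T_iff x_def)
  fix \<tau> assume nz: "boundary V x \<tau> \<noteq> 0"
  then have \<tau>: "\<tau> \<in> faces V k"
    using boundary_taylor_carrier[OF finite_V x] unfolding T_iff by blast
  then have "\<tau> \<subseteq> V" by (simp add: faces_def)
  then have b\<tau>: "boundary V x \<tau> = (\<Sum>j\<in>V - \<tau>. incidence_sign j \<tau> * x (insert j \<tau>))"
    by (simp add: boundary_def)
  then obtain j where j: "j \<in> V - \<tau>" "x (insert j \<tau>) \<noteq> 0"
    using nz by (metis (no_types, lifting) mult_zero_right sum.neutral)
  then have \<tau>_eq: "insert j \<tau> = ?\<rho>" by (auto simp: x_def split: if_splits)
  then have ij: "\<tau> = V - {i, j}" "i \<noteq> j" "j \<in> V" using j by auto
  show "\<exists>v. v \<notin> U \<tau> \<and> mon (insert v (U \<tau>)) dvd boundary V x \<tau>"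
  proof (rule strict_dvdI[of _ ?\<rho>])
    show "U \<tau> \<noteq> U ?\<rho>"
      unfolding ij(1) using edge U_Diff_pair_neq[OF ij(3) _ ij(2)] by blast
    show "mon (U ?\<rho>) dvd boundary V x \<tau>"
      unfolding b\<tau> by (intro dvd_sum dvd_mult) (simp add: x_def)
  qed (use ij in auto)
next
  fix z assume z: "z \<in> carrier (T (Suc (Suc k)))"
  let ?\<rho> = "V - {i}" and ?c = "squarefree_exponent (U (V - {i}))"
  have "mon (U V) dvd z V" using z unfolding T_iff by blast
  moreover have "U V \<noteq> U ?\<rho>" using i by (simp add: redundant_def)
  then have "\<not> U V \<subseteq> U ?\<rho>" using U_mono[of ?\<rho> V] by blast
  ultimately have "Poly_Mapping.lookup (z V) ?c = 0"
    unfolding squarefree_monomial_dvd_iff by (metis in_keys_iff keys_squarefree_exponent)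
  then have "Poly_Mapping.lookup (boundary V z ?\<rho>) ?c = 0"
    using i(1) by (simp add: boundary_Diff_singleton lookup_incidence_sign_mult)
  then show "\<exists>\<sigma>. Poly_Mapping.lookup ((if \<sigma> =
      ?\<rho> then mon (U ?\<rho>) else 0) - boundary V z \<sigma>) (squarefree_exponent (U \<sigma>)) \<noteq> 0"
    by (intro exI[of _ ?\<rho>]) (simp add: lookup_minus)
qed

text \<open>The cycle is one half of the boundary of the top face \<open>V\<close>, cut along the bipartition.\<close>

lemma lower_bound_bipartite:
  assumes card: "card V = Suc (Suc k)" and C: "C \<noteq> {}" and D: "D \<noteq> {}" "C \<inter> D = {}"
    and CD: "C \<union> D = redundant"
    and edge: "\<And>a b. a \<in> C \<Longrightarrow> b \<in> D \<Longrightarrow> U (V - {a, b}) \<noteq> U V"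
  shows "enat (Suc k) \<le> pd"
proof -
  \<comment> \<open>The summands of the boundary of the top face at the facets opposite to vertices
    of \<open>C\<close>; \<open>THE\<close> only recovers the removed vertex.\<close>
  define x where "x \<sigma> = (if \<exists>i\<in>C. \<sigma> = V - {i} then incidence_sign (THE i. i \<in> C \<and> \<sigma> =
      V - {i}) \<sigma> * mon (U V) else 0)" for \<sigma>
  have sub: "C \<subseteq> V" "D \<subseteq> V" using CD by (auto simp: redundant_def)
  have red: "U (V - {i}) = U V" if "i \<in> C \<or> i \<in> D" for i
    using that CD by (auto simp: redundant_def)
  have inj: "V - {i} = V - {j} \<longleftrightarrow> i = j" if "i \<in> V" "j \<in> V" for i j
    using that by blast
  have x_C: "x (V - {i}) = incidence_sign i (V - {i}) * mon (U V)" if "i \<in> C" for i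
  proof -
    have "(THE j. j \<in> C \<and> V - {i} = V - {j}) = i"
      by (rule the_equality) (use that sub in blast)+
    then show ?thesis using that by (auto simp: x_def)
  qed
  have x_0: "x (V - {i}) = 0" if "i \<in> V - C" for i
    using that sub by (auto simp: x_def)
  show ?thesis
  proof (rule lower_bound)
    show x: "x \<in> carrier (T (Suc k))"
      unfolding T_iff
    proof (intro allI conjI impI)
      show "x \<sigma> = 0" if "\<sigma> \<notin> faces V (Suc k)" for \<sigma>
        using that Diff_singleton_in_faces[OF finite_V card] sub by (auto simp: x_def)
      show "mon (U \<sigma>) dvd x \<sigma>" for \<sigma>
        using U_mono[of \<sigma> V] by (auto simp: x_def intro!: dvd_mult squarefree_monomial_dvd_mono)
    qed
    fix \<tau> assume nz: "boundary V x \<tau> \<noteq> 0"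
    then have "\<tau> \<in> faces V k"
      using boundary_taylor_carrier[OF finite_V x] unfolding T_iff by blast
    then obtain a b where ab: "a \<in> V" "b \<in> V" "a \<noteq> b" "\<tau> = V - {a, b}"
      using faces_card_minus_2[OF finite_V card] by blast
    note bd = boundary_Diff_pair[OF ab(1-3), of x, folded ab(4)]
    \<comment> \<open>A pair with exactly one member in \<open>C\<close> loses a variable either
      way: by \<open>edge\<close> if \<open>b\<close> is in \<open>D\<close>, by the variable that
      \<open>b\<close> owns if \<open>b\<close> is not redundant.\<close>
    have edge': "U (V - {a, b}) \<noteq> U V" if "a \<in> C" "b \<in> V - C" "a \<noteq> b" for a b
      using edge[OF that(1)] U_Diff_pair_neq[of b a] that red[of a] CD by (cases "b \<in> D") auto
    \<comment> \<open>With both vertices in \<open>C\<close> the two terms cancel as they do in the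
      boundary of a boundary.\<close>
    have "\<not> (a \<in> C \<and> b \<in> C)"
    proof
      assume "a \<in> C \<and> b \<in> C"
      moreover have "V - {b} = insert a \<tau>" "V - {a} = insert b \<tau>" using ab by auto
      moreover have "finite \<tau>" "a \<notin> \<tau>" "b \<notin> \<tau>" using ab finite_V by auto
      ultimately have "boundary V x \<tau> =
          (incidence_sign a \<tau> * incidence_sign b (insert a \<tau>) +
           incidence_sign b \<tau> * incidence_sign a (insert b \<tau>)) * mon (U V)"
        using bd x_C[of a] x_C[of b] by (simp add: distrib_right mult.assoc)
      with nz show False
        using incidence_sign_antisym[OF \<open>finite \<tau>\<close> \<open>a \<notin> \<tau>\<close> \<open>b \<notin> \<tau>\<close> ab(3),
            where 'a = "('n, 'k) mpoly"] by simp
    qed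
    moreover have "a \<in> C \<or> b \<in> C" using nz bd x_0 ab by auto
    ultimately have "U \<tau> \<noteq> U V"
      using edge'[of a b] edge'[of b a] ab by (auto simp: insert_commute)
    then show "\<exists>v. v \<notin> U \<tau> \<and> mon (insert v (U \<tau>)) dvd boundary V x \<tau>"
    proof (rule strict_dvdI[rotated])
      have "mon (U V) dvd x \<sigma>" for \<sigma> by (simp add: x_def)
      then show "mon (U V) dvd boundary V x \<tau>" unfolding bd by (intro dvd_add dvd_mult)
    qed (use ab in auto)
  next
    fix z assume z: "z \<in> carrier (T (Suc (Suc k)))"
    then have "mon (U V) dvd z V" unfolding T_iff by blast
    then obtain q where q: "z V = mon (U V) * q" by (auto simp: dvd_def)
    let ?c = "squarefree_exponent (U V)"
    obtain a b where ab: "a \<in> C" "b \<in> D" using C D by blast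
    have lookup_z: "Poly_Mapping.lookup (boundary V z (V - {i})) ?c =
        incidence_sign i (V - {i}) * Poly_Mapping.lookup q 0" if "i \<in> V" for i
      using that by (simp add: boundary_Diff_singleton lookup_incidence_sign_mult q
          lookup_squarefree_monomial_mult)
    have sign: "incidence_sign i \<sigma> \<noteq> (0 :: 'k)" for i \<sigma>
      using incidence_sign_square[of i \<sigma>, where 'a = 'k] by (metis mult_zero_left zero_neq_one)
    \<comment> \<open>Only the constant coefficient of \<open>q\<close> matters: the facet opposite
      to \<open>b\<close> in \<open>D\<close> forces it to be 0, the one opposite to
      \<open>a\<close> in \<open>C\<close> forces it to be 1.\<close>
    show "\<exists>\<sigma>. Poly_Mapping.lookup (x \<sigma> - boundary V z \<sigma>) (squarefree_exponent (U \<sigma>)) \<noteq> 0"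
    proof (rule ccontr)
      assume "\<not> ?thesis"
      then have 0: "Poly_Mapping.lookup (x \<sigma>) (squarefree_exponent (U \<sigma>)) =
          Poly_Mapping.lookup (boundary V z \<sigma>) (squarefree_exponent (U \<sigma>))" for \<sigma>
        by (auto simp: lookup_minus)
      have "b \<in> V - C" using ab D sub by blast
      then have "incidence_sign b (V - {b}) * Poly_Mapping.lookup q 0 = 0"
        using 0[of "V - {b}"] lookup_z[of b] x_0[of b] red[of b] \<open>b \<in> V - C\<close> ab(2) by simp
      then have "incidence_sign b (V - {b}) * (incidence_sign b (V - {b}) * Poly_Mapping.lookup q
          0) = 0"
        by simp
      then have "Poly_Mapping.lookup q 0 = 0"
        by (simp flip: mult.assoc)
      moreover have "incidence_sign a (V - {a}) * 1 =
          incidence_sign a (V - {a}) * Poly_Mapping.lookup q 0"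
        using 0[of "V - {a}"] lookup_z[of a] x_C[of a] red[of a] ab(1) subsetD[OF sub(1) ab(1)]
        by (simp add: lookup_incidence_sign_mult)
      ultimately show False using sign by simp
    qed
  qed
qed

end


section \<open>Upper bounds\<close>

context taylor_ideal
begin

lemma upper_bound:
  assumes k: "0 < k" and J: "J \<subseteq> faces V k"
    and J_inj: "\<And>y. y \<in> carrier (T k) \<Longrightarrow> (\<And>\<sigma>. \<sigma> \<notin> J \<Longrightarrow> y \<sigma> = 0) \<Longrightarrow>
      boundary V y = (\<lambda>_. 0) \<Longrightarrow> y = (\<lambda>_. 0)"
    and J_surj: "\<And>y. y \<in> carrier (T k) \<Longrightarrow>
      \<exists>z \<in> carrier (T (Suc k)). \<forall>\<sigma> \<in> faces V k - J. y \<sigma> = boundary V z \<sigma>"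
  shows "pd \<le> enat k"
proof -
  have fin_J: "finite J" using J finite_faces[OF finite_V] by (rule finite_subset)
  let ?P = "\<lambda>i. taylor_module A (if i < k then faces V i else if i = k then J else {})
    :: (('n, 'k) mpoly, nat set \<Rightarrow> ('n, 'k) mpoly) module"
  have J_iff: "y \<in> carrier (taylor_module A J) \<longleftrightarrow> y \<in> carrier (T k) \<and> (\<forall>\<sigma>. \<sigma> \<notin> J \<longrightarrow> y \<sigma> = 0)"
    for y :: "nat set \<Rightarrow> ('n, 'k) mpoly"
    unfolding T_iff taylor_module_carrier_iff[OF fin_J] U_def[symmetric] using J by blast
  have res: "projective_resolution polynomial_ring (quotient_module polynomial_ring I)
      ?P (\<lambda>_. boundary V) (\<lambda>y. I +>\<^bsub>polynomial_ring\<^esub> y {})"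
  proof (rule taylor_resolution[OF finite_V ideal_I I_eq k J])
    fix y :: "nat set \<Rightarrow> ('n, 'k) mpoly" assume y: "y \<in> carrier (T k)"
    obtain z where z: "z \<in> carrier (T (Suc k))" "\<forall>\<sigma> \<in> faces V k - J. y \<sigma> = boundary V z \<sigma>"
      using J_surj[OF y] by blast
    have bz: "boundary V z \<in> carrier (T k)" by (rule boundary_taylor_carrier[OF finite_V z(1)])
    have "(\<lambda>\<sigma>. y \<sigma> - boundary V z \<sigma>) \<in> carrier (taylor_module A J)"
      unfolding J_iff T_iff
    proof (intro conjI allI impI)
      fix \<sigma>
      show "y \<sigma> - boundary V z \<sigma> = 0" if "\<sigma> \<notin> faces V k"
        using that y bz unfolding T_iff by simp
      show "mon (U \<sigma>) dvd y \<sigma> - boundary V z \<sigma>"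
        using y bz unfolding T_iff by (blast intro: dvd_diff)
      show "y \<sigma> - boundary V z \<sigma> = 0" if "\<sigma> \<notin> J"
        using that z(2) y bz unfolding T_iff by (cases "\<sigma> \<in> faces V k") auto
    qed
    then show "\<exists>z\<in>carrier (T (Suc k)). (\<lambda>\<sigma>. y \<sigma> - boundary V z \<sigma>) \<in> carrier (taylor_module A J)"
      using z(1) by blast
  next
    fix y :: "nat set \<Rightarrow> ('n, 'k) mpoly"
    assume "y \<in> carrier (taylor_module A J)" "boundary V y = (\<lambda>_. 0)"
    then show "y = (\<lambda>_. 0)" using J_inj unfolding J_iff by blast
  qed
  \<comment> \<open>The prescribed type has functions on triples. Decoding the first component as a
    finite set of numbers suffices, because chains vanish on infinite sets.\<close>
  define \<psi> :: "(nat set \<Rightarrow> ('n, 'k) mpoly) \<Rightarrow> nat \<times> ('n, 'k) mpoly \<times> ('n, 'k) mpoly set \<Rightarrow> ('n, 'k)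
      mpoly"
    where "\<psi> y = (\<lambda>t. y (set_decode (fst t)))" for y
  have "inj_on \<psi> (carrier (?P i))" for i
  proof (rule inj_onI)
    fix x y :: "nat set \<Rightarrow> ('n, 'k) mpoly"
    let ?J = "if i < k then faces V i else if i = k then J else {}"
    assume x: "x \<in> carrier (?P i)" and y: "y \<in> carrier (?P i)" and eq: "\<psi> x = \<psi> y"
    have finJ: "finite ?J" using finite_faces[OF finite_V] fin_J by simp
    have "x \<sigma> = y \<sigma>" for \<sigma>
    proof (cases "finite \<sigma>")
      case True
      then show ?thesis using fun_cong[OF eq, of "(set_encode \<sigma>, 0, {})"] by (simp add: \<psi>_def)
    next
      case False
      have "?J \<subseteq> Pow V" using J by (auto simp: faces_def)
      then have "\<sigma> \<notin> ?J" using False finite_V finite_subset by blast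
      then show ?thesis using x y unfolding taylor_module_carrier_iff[OF finJ] by metis
    qed
    then show "x = y" by (rule ext)
  qed
  moreover have "carrier (?P i) = {\<zero>\<^bsub>?P i\<^esub>}" if "i > k" for i
    using that by (auto simp: taylor_module_def)
  ultimately show ?thesis
    by (rule projective_dimension_le[OF module_quotient_module[OF ideal_I cring_from_type_algebra]
        res])
qed

lemma T_diff:
  "x \<in> carrier (T k) \<Longrightarrow> y \<in> carrier (T k) \<Longrightarrow> (\<lambda>\<sigma>. x \<sigma> - y \<sigma>) \<in> carrier (T k)"
  unfolding T_iff by (auto intro: dvd_diff)

lemma incidence_sign_mult_cancel:
  "incidence_sign i \<sigma> * x = incidence_sign i \<sigma> * y \<longleftrightarrow> x = (y :: 'a :: comm_ring_1)"
  by (metis incidence_sign_square mult.assoc mult_1)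

text \<open>Redundancy gives \<open>V\<close> and \<open>V - {r}\<close> the same degree, so the
  entry of the last differential between them is a sign and can be inverted.\<close>

lemma facet_normalisation:
  assumes card: "card V = Suc k" and r: "r \<in> redundant" and y: "y \<in> carrier (T k)"
  shows "\<exists>z \<in> carrier (T (Suc k)). y (V - {r}) = boundary V z (V - {r})"
proof -
  have rV: "r \<in> V" "U (V - {r}) = U V" using r by (auto simp: redundant_def)
  define z where "z = (\<lambda>\<sigma>. if \<sigma> = V then incidence_sign r (V - {r}) * y (V - {r}) else 0)"
  have "mon (U V) dvd y (V - {r})" using y rV(2) unfolding T_iff by metis
  moreover have "V \<in> faces V (Suc k)" using card by (simp add: faces_def)
  ultimately have "z \<in> carrier (T (Suc k))" unfolding T_iff by (auto simp: z_def intro: dvd_mult)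
  moreover have "boundary V z (V - {r}) = y (V - {r})"
    using rV(1) by (simp add: boundary_Diff_singleton z_def flip: mult.assoc)
  ultimately show ?thesis by (metis)
qed

text \<open>The face \<open>V - {r}\<close> is cancelled against the top face. A cycle on the other
  facets is the boundary of a multiple of \<open>V\<close>, and its zero coefficient at
  \<open>V - {r}\<close> is that multiple up to sign.\<close>

lemma upper_bound_redundant:
  assumes card: "card V = Suc (Suc k)" and r: "r \<in> redundant"
  shows "pd \<le> enat (Suc k)"
proof (rule upper_bound)
  have rV: "r \<in> V" using r by (simp add: redundant_def)
  let ?J = "faces V (Suc k) - {V - {r}}"
  show "?J \<subseteq> faces V (Suc k)" by blast
  show "\<exists>z\<in>carrier (T (Suc (Suc k))). \<forall>\<sigma>\<in>faces V (Suc k) - ?J. y \<sigma> = boundary V z \<sigma>"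
    if y: "y \<in> carrier (T (Suc k))" for y
    using facet_normalisation[OF card r y] by auto
  fix y assume y: "y \<in> carrier (T (Suc k))" and J: "\<And>\<sigma>. \<sigma> \<notin> ?J \<Longrightarrow> y \<sigma> = 0"
    and cycle: "boundary V y = (\<lambda>_. 0)"
  obtain z where z: "z \<in> carrier (T (Suc (Suc k)))" "boundary V z = y"
    using taylor_complex_exact_Suc[OF finite_V y cycle] by blast
  have "incidence_sign r (V - {r}) * z V = incidence_sign r (V - {r}) * 0"
    using J[of "V - {r}"] z(2) boundary_Diff_singleton[OF rV, of z] by simp
  then have "z V = 0" unfolding incidence_sign_mult_cancel .
  moreover have "z \<sigma> = 0" if "\<sigma> \<noteq> V" for \<sigma>
    using z(1) that faces_card[OF finite_V] unfolding T_iff card by blast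
  ultimately have "z = (\<lambda>_. 0)" by (metis)
  then show "y = (\<lambda>_. 0)" using z(2) by (auto simp: boundary_def)
qed simp

text \<open>Along a tree with root \<open>r\<close> and parent function \<open>p\<close> the matrix of the differential at the
  faces \<open>V - {i, p i}\<close> is unitriangular up to signs, so that these faces can be dropped from the
  resolution.\<close>

lemma upper_bound_tree:
  assumes card: "card V = Suc (Suc (Suc k))" and r: "r \<in> redundant"
    and p: "\<And>i. i \<in> V - {r} \<Longrightarrow> p i \<in> redundant"
    and rk: "\<And>i. i \<in> V - {r} \<Longrightarrow> rk (p i) < (rk i :: nat)"
    and Up: "\<And>i. i \<in> V - {r} \<Longrightarrow> U (V - {i, p i}) = U (V - {i})"
  shows "pd \<le> enat (Suc k)"
proof (rule upper_bound)
  let ?\<tau> = "\<lambda>i. V - {i, p i}"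
  let ?J = "faces V (Suc k) - ?\<tau> ` (V - {r})"
  have rV: "r \<in> V" using r by (simp add: redundant_def)
  have pV: "p i \<in> V" "U (V - {p i}) = U V" "i \<noteq> p i" if "i \<in> V - {r}" for i
    using p[OF that] rk[OF that] by (auto simp: redundant_def)
  have bd: "boundary V z (?\<tau> i) = incidence_sign i (?\<tau> i) * z (V - {p i}) +
      incidence_sign (p i) (?\<tau> i) * z (V - {i})"
    if "i \<in> V - {r}" for i and z :: "nat set \<Rightarrow> ('n, 'k) mpoly"
    using boundary_Diff_pair[of i V "p i" z] that pV[OF that] by simp
  show "?J \<subseteq> faces V (Suc k)" by blast
  show "y = (\<lambda>_. 0)" if y: "y \<in> carrier (T (Suc k))" and J: "\<And>\<sigma>. \<sigma> \<notin> ?J \<Longrightarrow> y \<sigma> = 0"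
    and cycle: "boundary V y = (\<lambda>_. 0)" for y
  proof -
    obtain z where z: "z \<in> carrier (T (Suc (Suc k)))" "boundary V z = y"
      using taylor_complex_exact_Suc[OF finite_V y cycle] by blast
    \<comment> \<open>Subtracting a boundary makes the coefficient at the root facet zero and leaves
      \<open>boundary V z\<close> unchanged.\<close>
    obtain w where w: "w \<in> carrier (T (Suc (Suc (Suc k))))" "z (V - {r}) = boundary V w (V - {r})"
      using facet_normalisation[OF card r z(1)] by blast
    define z' where "z' \<sigma> = z \<sigma> - boundary V w \<sigma>" for \<sigma>
    have z': "z' \<in> carrier (T (Suc (Suc k)))"
      unfolding z'_def by (rule T_diff[OF z(1) boundary_taylor_carrier[OF finite_V w(1)]])
    have bz': "boundary V z' = y"
      unfolding z'_def boundary_diff boundary_boundary[OF finite_V] z(2) by simp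
    \<comment> \<open>Induction away from the root: at \<open>?\<tau> i\<close> the boundary of
      \<open>z'\<close> has only the terms from \<open>V - {p i}\<close>, already zero, and from
      \<open>V - {i}\<close>.\<close>
    have "z' (V - {i}) = 0" if "i \<in> V" for i
      using that
    proof (induction "rk i" arbitrary: i rule: less_induct)
      case less
      show ?case
      proof (cases "i = r")
        case True
        then show ?thesis by (simp add: z'_def w(2))
      next
        case False
        with less.prems have i: "i \<in> V - {r}" by blast
        have "z' (V - {p i}) = 0" by (rule less.hyps[OF rk[OF i] pV(1)[OF i]])
        moreover have "boundary V z' (?\<tau> i) = 0" unfolding bz' by (rule J) (use i in blast)
        ultimately have "incidence_sign (p i) (?\<tau> i) * z' (V - {i}) =
            incidence_sign (p i) (?\<tau> i) * 0"
          unfolding bd[OF i] by simp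
        then show ?thesis unfolding incidence_sign_mult_cancel .
      qed
    qed
    then have "z' \<sigma> = 0" for \<sigma>
      using z' faces_card_minus_1[OF finite_V card, of \<sigma>] unfolding T_iff by metis
    then show ?thesis unfolding bz'[symmetric] by (auto simp: boundary_def)
  qed
  show "\<exists>z\<in>carrier (T (Suc (Suc k))). \<forall>\<sigma>\<in>faces V (Suc k) - ?J. y \<sigma> = boundary V z \<sigma>"
    if y: "y \<in> carrier (T (Suc k))" for y
  proof -
    \<comment> \<open>Solves \<open>y = boundary V z\<close> at the face \<open>?\<tau> i\<close>
      for the coefficient of \<open>z\<close> at \<open>V - {i}\<close>, where \<open>w\<close> is
      the coefficient at the facet of the parent; the root gets the value 0.\<close>
    define step where "step i w = (if i = r then 0 else
      incidence_sign (p i) (?\<tau> i) * (y (?\<tau> i) - incidence_sign i (?\<tau> i) * w))" for i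
          and w :: "('n, 'k) mpoly"
    define \<zeta> where "\<zeta> = wfrec (measure rk) (\<lambda>f i. step i (f (p i)))"
    have \<zeta>: "\<zeta> i = step i (\<zeta> (p i))" if "i \<in> V" for i
    proof -
      have "\<zeta> i = step i (cut \<zeta> (measure rk) i (p i))"
        unfolding \<zeta>_def by (subst wfrec[OF wf_measure]) simp
      also have "\<dots> = step i (\<zeta> (p i))"
        using rk[of i] that by (cases "i = r") (simp_all add: step_def cut_def)
      finally show ?thesis .
    qed
    \<comment> \<open>The recursion stays in the module: the parent is redundant and contributes a
      multiple of \<open>mon (U V)\<close>, and by \<open>Up\<close> the face
      \<open>?\<tau> i\<close> has the same degree as \<open>V - {i}\<close>.\<close>
    have dvd: "mon (U (V - {i})) dvd \<zeta> i" if "i \<in> V" for i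
      using that
    proof (induction "rk i" arbitrary: i rule: less_induct)
      case less
      show ?case
      proof (cases "i = r")
        case True
        then have "\<zeta> i = 0" using \<zeta>[OF less.prems] by (simp add: step_def)
        then show ?thesis by simp
      next
        case False
        with less.prems have i: "i \<in> V - {r}" by blast
        have "mon (U V) dvd \<zeta> (p i)"
          using less.hyps[OF rk[OF i] pV(1)[OF i]] pV(2)[OF i] by simp
        then have "mon (U (V - {i})) dvd \<zeta> (p i)"
          by (rule dvd_trans[OF squarefree_monomial_dvd_mono[OF U_mono[OF Diff_subset]]])
        moreover have "mon (U (V - {i})) dvd y (?\<tau> i)"
          using y Up[OF i] unfolding T_iff by metis
        ultimately show ?thesis
          unfolding \<zeta>[OF less.prems] step_def by (simp add: dvd_mult dvd_diff)
      qed
    qed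
    define z where "z \<sigma> = (if \<sigma> \<in> faces V (Suc (Suc k)) then \<zeta> (THE i. i \<in> V \<and> \<sigma> =
        V - {i}) else 0)" for \<sigma>
    have z_eq: "z (V - {i}) = \<zeta> i" if "i \<in> V" for i
    proof -
      have "(THE j. j \<in> V \<and> V - {i} = V - {j}) = i"
        by (rule the_equality) (use that in blast)+
      then show ?thesis using Diff_singleton_in_faces[OF finite_V card that] by (simp add: z_def)
    qed
    have "z \<in> carrier (T (Suc (Suc k)))"
      unfolding T_iff
    proof (intro allI conjI impI)
      fix \<sigma>
      show "z \<sigma> = 0" if "\<sigma> \<notin> faces V (Suc (Suc k))" using that by (simp add: z_def)
      show "mon (U \<sigma>) dvd z \<sigma>"
      proof (cases "\<sigma> \<in> faces V (Suc (Suc k))")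
        case True
        then obtain i where "i \<in> V" "\<sigma> = V - {i}"
          using faces_card_minus_1[OF finite_V card] by blast
        then show ?thesis using dvd z_eq by simp
      qed (simp add: z_def)
    qed
    moreover have "y (?\<tau> i) = boundary V z (?\<tau> i)" if i: "i \<in> V - {r}" for i
    proof -
      have "boundary V z (?\<tau> i) = incidence_sign i (?\<tau> i) * \<zeta> (p i) +
          incidence_sign (p i) (?\<tau> i) * (incidence_sign (p i) (?\<tau> i) * (y (?\<tau> i) - incidence_sign
              i (?\<tau> i) * \<zeta> (p i)))"
        using i z_eq pV(1)[OF i] \<zeta>[of i] by (simp add: bd[OF i] step_def)
      also have "\<dots> = y (?\<tau> i)" by (simp flip: mult.assoc)
      finally show ?thesis by simp
    qed
    ultimately show ?thesis by blast
  qed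
qed simp

text \<open>On redundant vertices the rank is the distance from \<open>r\<close> in the graph of
  non-adjacent pairs, and the parent is the predecessor on a shortest path. The other vertices of
  \<open>V\<close> are attached as leaves.\<close>

lemma tree_exists:
  assumes r: "r \<in> redundant"
    and connected: "\<And>C D. C \<noteq> {} \<Longrightarrow> D \<noteq> {} \<Longrightarrow> C \<inter> D = {} \<Longrightarrow> C \<union> D = redundant \<Longrightarrow>
      \<exists>a\<in>C. \<exists>b\<in>D. U (V - {a, b}) = U V"
    and attach: "\<And>i. i \<in> V - redundant \<Longrightarrow> \<exists>j\<in>redundant. U (V - {i, j}) = U (V - {i})"
  shows "\<exists>p (rk :: nat \<Rightarrow> nat). \<forall>i\<in>V - {r}. p i \<in> redundant \<and> rk (p i) < rk i \<and> U (V - {i, p i}) =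
      U (V - {i})"
proof -
  define E where "E = {(a, b). a \<in> redundant \<and> b \<in> redundant \<and> U (V - {a, b}) = U V}"
  let ?C = "{b \<in> redundant. (r, b) \<in> E\<^sup>*}"
  have reach: "(r, b) \<in> E\<^sup>*" if "b \<in> redundant" for b
  proof (rule ccontr)
    assume b: "(r, b) \<notin> E\<^sup>*"
    \<comment> \<open>If some redundant vertex is unreachable, the component of \<open>r\<close> and
      its complement form a bipartition, to which \<open>connected\<close> applies.\<close>
    have "\<exists>a\<in>?C. \<exists>b\<in>redundant - ?C. U (V - {a, b}) = U V"
      by (rule connected) (use r b that in auto)
    then obtain a c where "a \<in> ?C" "c \<in> redundant - ?C" "U (V - {a, c}) = U V" by blast
    then have "(r, a) \<in> E\<^sup>*" "(a, c) \<in> E" "c \<in> redundant" "(r, c) \<notin> E\<^sup>*" by (auto simp: E_def)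
    then show False by (meson rtrancl.rtrancl_into_rtrancl)
  qed
  define rk0 where "rk0 b = (LEAST n. (r, b) \<in> E ^^ n)" for b
  have fin: "finite redundant" using finite_V by (simp add: redundant_def)
  \<comment> \<open>The sum merely bounds all ranks on \<open>redundant\<close>; the successor
    places the leaves strictly above their parents.\<close>
  define rk where "rk i = (if i \<in> redundant then rk0 i else Suc (sum rk0 redundant))" for i
  have "\<exists>j. j \<in> redundant \<and> rk j < rk i \<and> U (V - {i, j}) = U (V - {i})" if i: "i \<in> V - {r}" for i
  proof (cases "i \<in> redundant")
    case True
    have "\<exists>n. (r, i) \<in> E ^^ n" using reach[OF True] by (simp add: rtrancl_power)
    then have rk_i: "(r, i) \<in> E ^^ rk0 i" unfolding rk0_def by (rule LeastI_ex)
    then obtain n where n: "rk0 i = Suc n" using i by (cases "rk0 i") auto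
    with rk_i obtain j where j: "(r, j) \<in> E ^^ n" "(j, i) \<in> E" by auto
    have "rk0 j \<le> n" unfolding rk0_def by (rule Least_le) (rule j(1))
    moreover have "j \<in> redundant" "U (V - {i, j}) = U V" using j(2)
        by (auto simp: E_def insert_commute)
    moreover have "U (V - {i}) = U V" using True by (simp add: redundant_def)
    ultimately show ?thesis using True n by (intro exI[of _ j]) (simp add: rk_def)
  next
    case False
    then obtain j where j: "j \<in> redundant" "U (V - {i, j}) = U (V - {i})" using attach[of i] i
        by blast
    have "rk0 j \<le> sum rk0 redundant" by (rule member_le_sum[OF j(1) _ fin]) simp
    then show ?thesis using j False by (intro exI[of _ j]) (simp add: rk_def)
  qed
  then have "\<exists>p. \<forall>i\<in>V - {r}. p i \<in> redundant \<and> rk (p i) < rk i \<and> U (V - {i, p i}) = U (V - {i})"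
    by (intro bchoice) blast
  then show ?thesis by blast
qed

end


section \<open>The hypergraph\<close>

context taylor_ideal
begin

definition support_hypergraph :: "nat set set" where
  "support_hypergraph = {{j \<in> V. v \<in> A j} | v. True}"

text \<open>The variable behind a singleton face is one that only \<open>i\<close> contributes to
  the lcm.\<close>

lemma singleton_in_hypergraph_iff:
  assumes "i \<in> V"
  shows "{i} \<in> support_hypergraph \<longleftrightarrow> i \<notin> redundant"
proof -
  have "{i} = {j \<in> V. v \<in> A j} \<longleftrightarrow> v \<in> U V - U (V - {i})" for v
    using assms by (auto simp: U_def)
  then have "{i} \<in> support_hypergraph \<longleftrightarrow> U V - U (V - {i}) \<noteq> {}"
    unfolding support_hypergraph_def by blast
  then show ?thesis using assms U_mono[of "V - {i}" V] by (auto simp: redundant_def)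
qed

text \<open>A variable lost when \<open>j\<close> is removed from \<open>V - {i}\<close> occurs in
  \<open>A j\<close> and, \<open>j\<close> being redundant, in another generator as well; only that
  of \<open>i\<close> is left.\<close>

lemma pair_in_hypergraph_iff_private:
  assumes i: "i \<in> V" and j: "j \<in> redundant" and "i \<noteq> j"
  shows "{i, j} \<in> support_hypergraph \<longleftrightarrow> U (V - {i, j}) \<noteq> U (V - {i})"
proof -
  have jV: "j \<in> V" "U (V - {j}) = U V" using j by (auto simp: redundant_def)
  have "{i, j} = {l \<in> V. v \<in> A l} \<longleftrightarrow> v \<in> U (V - {i}) - U (V - {i, j})" for v
  proof
    assume "{i, j} = {l \<in> V. v \<in> A l}"
    then show "v \<in> U (V - {i}) - U (V - {i, j})" using assms jV(1) by (auto simp: U_def)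
  next
    assume v: "v \<in> U (V - {i}) - U (V - {i, j})"
    then have "v \<in> U (V - {j})" unfolding jV(2) using U_mono[of "V - {i}" V] by blast
    then show "{i, j} = {l \<in> V. v \<in> A l}" using v assms(1) jV(1) by (auto simp: U_def)
  qed
  then have "{i, j} \<in> support_hypergraph \<longleftrightarrow> U (V - {i}) - U (V - {i, j}) \<noteq> {}"
    unfolding support_hypergraph_def by blast
  then show ?thesis using U_mono[of "V - {i, j}" "V - {i}"] by auto
qed

lemma singleton_vertices_hypergraph: "singleton_vertices V support_hypergraph = V - redundant"
  using singleton_in_hypergraph_iff by (auto simp: singleton_vertices_def)

lemma nonsingleton_vertices_hypergraph: "nonsingleton_vertices V support_hypergraph = redundant"
  unfolding nonsingleton_vertices_def singleton_vertices_hypergraph by (auto simp: redundant_def)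

lemma pair_in_hypergraph_iff_redundant:
  assumes "a \<in> redundant" "b \<in> redundant" "a \<noteq> b"
  shows "{a, b} \<in> support_hypergraph \<longleftrightarrow> U (V - {a, b}) \<noteq> U V"
  using pair_in_hypergraph_iff_private[of a b] assms by (simp add: redundant_def)

lemma spanning_complete_bipartite_iff:
  "has_spanning_complete_bipartite_subgraph redundant (two_faces_in support_hypergraph redundant) \<longleftrightarrow>
    (\<exists>C D. C \<noteq> {} \<and> D \<noteq> {} \<and> C \<inter> D = {} \<and> C \<union> D = redundant \<and>
      (\<forall>a\<in>C. \<forall>b\<in>D. U (V - {a, b}) \<noteq> U V))" (is "_ \<longleftrightarrow> (\<exists>C D. ?Q C D)")
proof -
  have edge: "{a, b} \<in> two_faces_in support_hypergraph redundant \<longleftrightarrow> U (V - {a, b}) \<noteq> U V"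
    if "C \<inter> D = {}" "C \<union> D = redundant" "a \<in> C" "b \<in> D" for C D a b
  proof -
    have "a \<in> redundant" "b \<in> redundant" "a \<noteq> b" using that by blast+
    then show ?thesis
      using pair_in_hypergraph_iff_redundant[of a b] by (simp add: two_faces_in_def)
  qed
  show ?thesis
  proof
    assume "has_spanning_complete_bipartite_subgraph redundant (two_faces_in support_hypergraph
        redundant)"
    then obtain C D where CD: "C \<noteq> {}" "D \<noteq> {}" "C \<inter> D = {}" "C \<union> D = redundant"
      and sub: "{{a, b} | a b. a \<in> C \<and> b \<in> D} \<subseteq> two_faces_in support_hypergraph redundant"
      unfolding has_spanning_complete_bipartite_subgraph_def complete_bipartite_graph_def
          by (elim exE conjE) simp
    have "U (V - {a, b}) \<noteq> U V" if "a \<in> C" "b \<in> D" for a b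
    proof -
      have "{a, b} \<in> {{a, b} | a b. a \<in> C \<and> b \<in> D}"
        using that by (intro CollectI exI[of _ a] exI[of _ b] conjI refl)
      then have "{a, b} \<in> two_faces_in support_hypergraph redundant" by (rule subsetD[OF sub])
      then show ?thesis using edge[OF CD(3,4) that] by simp
    qed
    then show "\<exists>C D. ?Q C D" by (intro exI[of _ C] exI[of _ D] conjI ballI CD)
  next
    assume "\<exists>C D. ?Q C D"
    then obtain C D where CD: "C \<noteq> {}" "D \<noteq> {}" "C \<inter> D = {}" "C \<union> D = redundant"
      and e: "\<forall>a\<in>C. \<forall>b\<in>D. U (V - {a, b}) \<noteq> U V" by blast
    have "{{a, b} | a b. a \<in> C \<and> b \<in> D} \<subseteq> two_faces_in support_hypergraph redundant"
    proof
      fix F assume "F \<in> {{a, b} | a b. a \<in> C \<and> b \<in> D}"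
      then obtain a b where ab: "a \<in> C" "b \<in> D" "F = {a, b}" by (elim CollectE exE conjE)
      then show "F \<in> two_faces_in support_hypergraph redundant"
        using edge[OF CD(3,4) ab(1,2)] e by simp
    qed
    then show "has_spanning_complete_bipartite_subgraph redundant (two_faces_in support_hypergraph
        redundant)"
      unfolding has_spanning_complete_bipartite_subgraph_def complete_bipartite_graph_def
      using CD by (intro exI[of _ "{{a, b} | a b. a \<in> C \<and> b \<in>
          D}"] conjI exI[of _ C] exI[of _ D] refl)
  qed
qed

text \<open>Without redundant vertices \<open>pd\<close> is at least \<open>card V\<close>.
  Otherwise it is at most \<open>card V - 1\<close>, with equality if one of the two conditions
  supplies a cycle; if both fail, their negations are the hypotheses of
  \<open>tree_exists\<close>.\<close>

lemma projective_dimension_iff: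
  assumes nonempty: "\<And>j. j \<in> V \<Longrightarrow> A j \<noteq> {}"
  shows "pd + 1 = enat (card V) \<longleftrightarrow>
    redundant \<noteq> {} \<and>
    ((\<exists>C D. C \<noteq> {} \<and> D \<noteq> {} \<and> C \<inter> D = {} \<and> C \<union> D = redundant \<and>
      (\<forall>a\<in>C. \<forall>b\<in>D. U (V - {a, b}) \<noteq> U V)) \<or>
     (\<exists>i\<in>V - redundant. \<forall>j\<in>redundant. U (V - {i, j}) \<noteq> U (V - {i})))"
    (is "_ \<longleftrightarrow> _ \<and> (?bip \<or> ?priv)")
proof (cases "redundant = {}")
  case True
  have "pd + 1 \<noteq> enat (card V)"
  proof (cases "card V")
    case 0
    then show ?thesis by (cases pd) (auto simp: one_enat_def)
  next
    case (Suc k)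
    then have "enat (card V) \<le> pd" using lower_bound_no_redundant[OF True] by blast
    then show ?thesis by (cases pd) (auto simp: one_enat_def)
  qed
  with True show ?thesis by blast
next
  case False
  then obtain r where r: "r \<in> redundant" by blast
  then have rV: "r \<in> V" "U (V - {r}) = U V" by (auto simp: redundant_def)
  \<comment> \<open>If \<open>r\<close> were the only vertex, removing it would leave no variables,
    although \<open>r\<close> is redundant and \<open>A r\<close> is not empty.\<close>
  have "V - {r} \<noteq> {}"
    using rV nonempty[OF rV(1)] by (auto simp: U_def)
  then have "card (V - {r}) \<noteq> 0" using finite_V by simp
  then obtain k where k: "card (V - {r}) = Suc k" using not0_implies_Suc by blast
  have card: "card V = Suc (Suc k)"
    using card_Suc_Diff1[OF finite_V rV(1)] unfolding k by (rule sym)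
  have upper: "pd \<le> enat (Suc k)" by (rule upper_bound_redundant[OF card r])
  have pd_iff: "pd + 1 = enat (card V) \<longleftrightarrow> enat (Suc k) \<le> pd"
    using upper card by (cases pd) (auto simp: one_enat_def)
  show ?thesis
  proof (cases "?bip \<or> ?priv")
    case True
    then have "enat (Suc k) \<le> pd"
    proof
      assume ?bip
      then obtain C D where "C \<noteq> {}" "D \<noteq> {}" "C \<inter> D = {}" "C \<union> D = redundant"
        "\<forall>a\<in>C. \<forall>b\<in>D. U (V - {a, b}) \<noteq> U V" by blast
      then show ?thesis by (intro lower_bound_bipartite[OF card, of C D]) auto
    next
      assume ?priv
      then show ?thesis using lower_bound_private[OF card] by blast
    qed
    then show ?thesis using True False pd_iff by blast
  next
    case neg: False
    have "\<exists>p (rk :: nat \<Rightarrow> nat). \<forall>i\<in>V - {r}. p i \<in> redundant \<and> rk (p i) < rk i \<and> U (V - {i, p i}) =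
        U (V - {i})"
    proof (rule tree_exists[OF r])
      fix C D assume CD: "C \<noteq> {}" "D \<noteq> {}" "C \<inter> D = {}" "C \<union> D = redundant"
      show "\<exists>a\<in>C. \<exists>b\<in>D. U (V - {a, b}) = U V"
      proof (rule ccontr)
        assume "\<not> ?thesis"
        then have "\<forall>a\<in>C. \<forall>b\<in>D. U (V - {a, b}) \<noteq> U V" by simp
        with CD have ?bip by (intro exI[of _ C] exI[of _ D] conjI)
        then have "?bip \<or> ?priv" by (rule disjI1)
        with neg show False by (rule notE)
      qed
    next
      fix i assume i: "i \<in> V - redundant"
      from neg have "\<not> ?priv" by blast
      with i show "\<exists>j\<in>redundant. U (V - {i, j}) = U (V - {i})" by simp
    qed
    then obtain p and rk :: "nat \<Rightarrow> nat" where p: "\<And>i. i \<in> V - {r} \<Longrightarrow> p i \<in> redundant"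
      "\<And>i. i \<in> V - {r} \<Longrightarrow> rk (p i) < rk i" "\<And>i. i \<in> V - {r} \<Longrightarrow> U (V - {i, p i}) = U (V - {i})"
      by blast
    \<comment> \<open>Shortening by two steps needs three vertices. With only two,
      \<open>V - {i, p i}\<close> is empty and has no variables, whereas \<open>V - {i}\<close>
      still contains \<open>p i\<close>.\<close>
    have "k \<noteq> 0"
    proof
      assume "k = 0"
      obtain i where i: "i \<in> V - {r}" using \<open>V - {r} \<noteq> {}\<close> by blast
      have pi: "p i \<in> V" "p i \<noteq> i" using p(1,2)[OF i] by (auto simp: redundant_def)
      have "card {i, p i} = card V" using pi(2) card \<open>k = 0\<close> by simp
      then have "{i, p i} = V" using i pi finite_V by (intro card_subset_eq) auto
      then have "U (V - {i, p i}) = {}" "A (p i) \<subseteq> U (V - {i})" using pi by (auto simp: U_def)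
      then show False using p(3)[OF i] nonempty[OF pi(1)] by blast
    qed
    then obtain k' where k': "k = Suc k'" by (cases k) auto
    have "pd \<le> enat (Suc k')"
      by (rule upper_bound_tree[where p = p and rk = rk, OF _ r]) (use p card k' in auto)
    then have "\<not> enat (Suc k) \<le> pd" by (cases pd) (auto simp: k')
    then show ?thesis using neg False pd_iff by blast
  qed
qed

end

theorem theorem4p3:
  fixes I :: "('n :: finite, 'k :: field) mpoly set"
    and m :: "nat \<Rightarrow> ('n, 'k) mpoly"
    and \<mu> :: nat
  assumes "squarefree_monomial_ideal I"
    and "I \<noteq> UNIV"
    and "inj_on m {1..\<mu>}"
    and "minimal_monomial_generators I (m ` {1..\<mu>})"
  defines "V \<equiv> {1..\<mu>}"
    and "H \<equiv> ideal_hypergraph \<mu> m"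
  defines "B \<equiv> singleton_vertices V H"
    and "W \<equiv> nonsingleton_vertices V H"
  shows
    "projective_dimension polynomial_ring (quotient_module polynomial_ring I) + 1 = enat \<mu> \<longleftrightarrow>
    B \<noteq> V \<and>
    (has_spanning_complete_bipartite_subgraph W (two_faces_in H W) \<or>
     (\<exists>i \<in> B. \<forall>j \<in> W. {i, j} \<in> H))"
proof -
  obtain A where mA: "\<forall>j\<in>V. m j = squarefree_monomial (A j)"
    and I_eq: "I = {p. \<forall>c \<in> Poly_Mapping.keys p. \<exists>j\<in>V. A j \<subseteq> Poly_Mapping.keys c}"
    using squarefree_ideal_representation[OF assms(1,4)] unfolding V_def by blast
  have "ideal I polynomial_ring"
    using assms(4) ring.genideal_ideal[OF ring_from_type_algebra, of "m ` {1..\<mu>}"]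
    by (simp add: minimal_monomial_generators_def)
  then interpret taylor_ideal V A I
    by (intro taylor_ideal.intro I_eq) (simp_all add: V_def)
  \<comment> \<open>An empty \<open>A j\<close> would mean the generator 1, and \<open>I\<close>
    would be the whole ring.\<close>
  have nonempty: "A j \<noteq> {}" if "j \<in> V" for j
    using assms(2) that unfolding I_eq by auto
  have H: "H = support_hypergraph"
  proof -
    have "{j \<in> {1..\<mu>}. indeterminate v dvd m j} = {j \<in> V. v \<in> A j}" for v
      using mA by (auto simp: V_def indeterminate_dvd_squarefree_monomial_iff)
    then show ?thesis unfolding H_def ideal_hypergraph_def support_hypergraph_def by simp
  qed
  have B: "B = V - redundant" unfolding B_def H by (rule singleton_vertices_hypergraph)
  have W: "W = redundant" unfolding W_def H by (rule nonsingleton_vertices_hypergraph)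
  have BV: "B \<noteq> V \<longleftrightarrow> redundant \<noteq> {}" unfolding B by (auto simp: redundant_def)
  have "{i, j} \<in> H \<longleftrightarrow> U (V - {i, j}) \<noteq> U (V - {i})" if "i \<in> B" "j \<in> W" for i j
    unfolding H by (rule pair_in_hypergraph_iff_private) (use that in \<open>auto simp: B W\<close>)
  then have priv: "(\<exists>i \<in> B. \<forall>j \<in> W. {i, j} \<in> H) \<longleftrightarrow>
      (\<exists>i\<in>V - redundant. \<forall>j\<in>redundant. U (V - {i, j}) \<noteq> U (V - {i}))"
    unfolding B W by blast
  have "card V = \<mu>" by (simp add: V_def)
  then show ?thesis
    using projective_dimension_iff[OF nonempty]
    unfolding BV priv unfolding W H spanning_complete_bipartite_iff by simp
qed

end
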